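(* Let $A\in\mathbb{R}^{m\times n}$ have rank $n$ and let $b\in\mathbb{R}^m$. Let $\beta>0$ and let $\{W_k\}_{k\ge 1}$ be a sequence of i.i.d. $m\times\ell$ random matrices with $\mathbb{E}(W_kW_k^\top)=\beta I_m$ and $\mathbb{E}(\|W_kW_k^\top\|^2)<\infty$. Define $\mathcal{F}_k=\sigma(W_i;\, i<k)$. Let $\{\alpha_k\}_{k\ge1}$ be a positive sequence of (deterministic) scalars, and let $\{B_k\}_{k\ge1}$ be a sequence of random $n\times n$ symmetric positive definite matrices adapted to $\{\mathcal{F}_k\}$ such that, for some constant $B>0$, $$\|B_k\|=\lambda_{\max}(B_k)\le B\quad\text{a.s. for all }k,$$ and $$\sum_{k=1}^\infty \alpha_k\,\lambda_{\min}(B_k)=\infty\ \text{ a.s.}\qquad\text{and}\qquad \sum_{k=1}^\infty\alpha_k^2<\infty.$$ Set $\widehat{x}=(A^\top A)^{-1}A^\top b$ and $\widehat{b}=A\widehat{x}$, and let $x_0\in\mathbb{R}^n$ be an arbitrary initial vector. For $k\ge1$ define $$x_k=x_{k-1}+\alpha_k s_k,\qquad s_k=-B_kA^\top W_kW_k^\top(Ax_{k-1}-b),\qquad b_k=Ax_{k-1}.$$ Then: (i) The matrix $C=\mathbb{E}(W_kW_k^\top W_kW_k^\top)$ is defined (i.e. the expectation exists and is finite) and is symmetric positive definite. (ii) If $e_k=\|b_k-\widehat{b}\|^2$, then $\mathbb{E}\,e_k<\infty$ and $\mathbb{E}(\|s_k\|^2)<\infty$ for all $k$. (iii) $x_k\to\widehat{x}$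 almost surely as $k\to\infty$.
   Context: All random objects live on a common probability space. $\|\cdot\|$ denotes the Euclidean norm of a vector and the spectral (operator two-) norm of a matrix; $I_m$ is the $m\times m$ identity matrix; $\lambda_{\min}$ and $\lambda_{\max}$ denote the smallest and largest eigenvalues of a symmetric matrix. $\sigma(W_i;\,i<k)$ is the $\sigma$-algebra generated by $W_1,\dots,W_{k-1}$ (trivial for $k=1$). The sequence $\{B_k\}$ is adapted to $\{\mathcal{F}_k\}$ if $B_k$ is $\mathcal{F}_k$-measurable for every $k$. The initial vector $x_0$ is deterministic. *)

theory Defs
  imports "HOL-Probability.Probability"
begin

text \<open>The type-class norm on \<open>real ^ 'n ^ 'm\<close> is the Frobenius norm, so the operator two-norm
  has to be introduced separately.\<close>

definition spectral_norm :: "real ^ 'n ^ 'm \<Rightarrow> real" where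
  "spectral_norm P = onorm ((*v) P)"

definition sym_pos_def :: "real ^ 'n ^ 'n \<Rightarrow> bool" where
  "sym_pos_def P \<longleftrightarrow> transpose P = P \<and> (\<forall>v. v \<noteq> 0 \<longrightarrow> v \<bullet> (P *v v) > 0)"

definition eigenvalues :: "real ^ 'n ^ 'n \<Rightarrow> real set" where
  "eigenvalues P = {c. \<exists>v. v \<noteq> 0 \<and> P *v v = c *\<^sub>R v}"

text \<open>Only meaningful for symmetric matrices, where the set of real eigenvalues is
  finite and nonempty (shown below).\<close>

definition lambda_min :: "real ^ 'n ^ 'n \<Rightarrow> real" where
  "lambda_min P = Min (eigenvalues P)"

definition lambda_max :: "real ^ 'n ^ 'n \<Rightarrow> real" where
  "lambda_max P = Max (eigenvalues P)"

text \<open>The sequence \<open>W\<close> is indexed from 1; the value \<open>W 0\<close> is never used.\<close>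

definition past_sigma :: "'w measure \<Rightarrow> (nat \<Rightarrow> 'w \<Rightarrow> 'b::topological_space) \<Rightarrow> nat \<Rightarrow> 'w measure" where
  "past_sigma M W k =
     sigma (space M) {W i -` S \<inter> space M | i S. 1 \<le> i \<and> i < k \<and> S \<in> sets borel}"

lemma symmetric_inner:
  fixes P :: "real ^ 'n ^ 'n"
  assumes "transpose P = P"
  shows "(P *v u) \<bullet> v = u \<bullet> (P *v v)"
  by (metis assms dot_lmul_matrix vector_transpose_matrix)

lemma finite_eigenvalues:
  fixes P :: "real ^ 'n ^ 'n"
  assumes "transpose P = P"
  shows "finite (eigenvalues P)"
proof -
  have "\<exists>f. \<forall>c \<in> eigenvalues P. f c \<noteq> 0 \<and> P *v f c = c *\<^sub>R f c"
    unfolding eigenvalues_def by (intro bchoice) auto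
  then obtain f where f: "\<And>c. c \<in> eigenvalues P \<Longrightarrow> f c \<noteq> 0 \<and> P *v f c = c *\<^sub>R f c"
    by blast
  have orth: "orthogonal (f c) (f d)"
    if "c \<in> eigenvalues P" "d \<in> eigenvalues P" "c \<noteq> d" for c d
  proof -
    have "c * (f c \<bullet> f d) = d * (f c \<bullet> f d)"
      using symmetric_inner[OF assms, of "f c" "f d"] f that by simp
    then show ?thesis using that by (simp add: orthogonal_def)
  qed
  have "inj_on f (eigenvalues P)"
    using orth f by (metis inj_onI orthogonal_self)
  moreover have "pairwise orthogonal (f ` eigenvalues P)"
    unfolding pairwise_def using orth by blast
  then have "independent (f ` eigenvalues P)"
    using f by (intro pairwise_orthogonal_independent) auto
  ultimately show ?thesis
    using finite_imageD independent_imp_finite by blast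
qed

lemma spectral_norm_eigenvalue:
  fixes P :: "real ^ 'n ^ 'n"
  assumes "transpose P = P"
  shows "spectral_norm P \<in> eigenvalues P \<or> - spectral_norm P \<in> eigenvalues P"
proof -
  let ?s = "spectral_norm P"
  have bl: "bounded_linear ((*v) P)" by simp
  have le: "norm (P *v w) \<le> ?s * norm w" for w
    unfolding spectral_norm_def using onorm[OF bl] .
  have "compact (sphere (0 :: real ^ 'n) 1)" by simp
  moreover have "sphere (0 :: real ^ 'n) 1 \<noteq> {}" by simp
  moreover have "continuous_on (sphere 0 1) (\<lambda>w. norm (P *v w))"
    by (intro continuous_intros)
  ultimately obtain v where v: "norm v = 1"
    and mx: "\<And>w. norm w = 1 \<Longrightarrow> norm (P *v w) \<le> norm (P *v v)"
    using continuous_attains_sup[of "sphere (0 :: real ^ 'n) 1" "\<lambda>w. norm (P *v w)"]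
    by (auto simp: sphere_def dist_norm)
  have "norm (P *v w) \<le> norm (P *v v) * norm w" for w
  proof (cases "w = 0")
    case False
    then have "norm (P *v (w /\<^sub>R norm w)) \<le> norm (P *v v)"
      by (intro mx) simp
    then show ?thesis
      using False by (simp add: matrix_vector_mult_scaleR field_simps)
  qed simp
  then have s: "norm (P *v v) = ?s"
    using le[of v] v by (simp add: spectral_norm_def onorm_le antisym)
  have "norm (P *v (P *v v) - ?s\<^sup>2 *\<^sub>R v)^2
      = norm (P *v (P *v v))^2 - 2 * ?s\<^sup>2 * ((P *v (P *v v)) \<bullet> v) + ?s ^ 4 * norm v ^ 2"
    unfolding power2_norm_eq_inner
    by (simp add: inner_diff_left inner_diff_right inner_commute algebra_simps
        power2_eq_square power4_eq_xxxx)
  also have "(P *v (P *v v)) \<bullet> v = ?s\<^sup>2"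
    using symmetric_inner[OF assms, of "P *v v" v] s by (metis power2_norm_eq_inner)
  also have "norm (P *v (P *v v))^2 - 2 * ?s\<^sup>2 * ?s\<^sup>2 + ?s ^ 4 * norm v ^ 2 \<le> 0"
    using power_mono[OF le[of "P *v v"], of 2] s v
    by (simp add: power2_eq_square power4_eq_xxxx)
  finally have sq: "P *v (P *v v) = ?s\<^sup>2 *\<^sub>R v" by simp
  show ?thesis
  proof (cases "P *v v = ?s *\<^sub>R v")
    case True
    moreover have "v \<noteq> 0" using v by auto
    ultimately show ?thesis unfolding eigenvalues_def by blast
  next
    case False
    have "P *v (P *v v - ?s *\<^sub>R v) = - ?s *\<^sub>R (P *v v - ?s *\<^sub>R v)"
      by (simp add: matrix_vector_mult_diff_distrib matrix_vector_mult_scaleR sq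
          scaleR_diff_right power2_eq_square)
    moreover have "P *v v - ?s *\<^sub>R v \<noteq> 0" using False by simp
    ultimately show ?thesis unfolding eigenvalues_def by blast
  qed
qed

lemma eigenvalues_nonempty:
  fixes P :: "real ^ 'n ^ 'n"
  assumes "transpose P = P"
  shows "eigenvalues P \<noteq> {}"
  using spectral_norm_eigenvalue[OF assms] by blast

lemma spectral_norm_eq_lambda_max:
  fixes P :: "real ^ 'n ^ 'n"
  assumes "sym_pos_def P"
  shows "spectral_norm P = lambda_max P"
proof -
  have sym: "transpose P = P" using assms by (simp add: sym_pos_def_def)
  have pos: "c > 0" if c: "c \<in> eigenvalues P" for c
  proof -
    obtain v where "v \<noteq> 0" "P *v v = c *\<^sub>R v" using c by (auto simp: eigenvalues_def)
    then have "0 < c * (v \<bullet> v)" "0 < v \<bullet> v" using assms by (force simp: sym_pos_def_def)+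
    then show ?thesis by (rule zero_less_mult_pos2)
  qed
  have "spectral_norm P \<ge> 0"
    unfolding spectral_norm_def by (intro onorm_pos_le) simp
  then have mem: "spectral_norm P \<in> eigenvalues P"
    using spectral_norm_eigenvalue[OF sym] pos by fastforce
  have "c \<le> spectral_norm P" if c: "c \<in> eigenvalues P" for c
  proof -
    obtain v where v: "v \<noteq> 0" "P *v v = c *\<^sub>R v" using c by (auto simp: eigenvalues_def)
    have "norm (P *v v) \<le> spectral_norm P * norm v"
      unfolding spectral_norm_def by (intro onorm) simp
    then show ?thesis using v pos[OF c] by simp
  qed
  then show ?thesis
    unfolding lambda_max_def using finite_eigenvalues[OF sym] mem by (intro Max_eqI[symmetric])
qed

end

theory Submission
  imports Defs
begin

text \<open>
  Write \<open>u\<^sub>k = x\<^sub>k - xhat\<close>, \<open>r = b - A xhat\<close> and \<open>S\<^sub>k\<close> for the sketch \<open>W W\<^sup>T\<close> of the step that leads from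
  \<open>x\<^sub>k\<close> to \<open>x\<^sub>k\<^sub>+\<^sub>1\<close>. The normal equations say \<open>A\<^sup>T r = 0\<close>, so the update reads
  \<open>u\<^sub>k\<^sub>+\<^sub>1 = u\<^sub>k - \<alpha> B A\<^sup>T S\<^sub>k (A u\<^sub>k - r)\<close>, and since \<open>S\<^sub>k\<close> is independent of the past with mean \<open>\<beta> I\<close> it is, on
  average, a step along \<open>- B g\<close> with the gradient \<open>g = A\<^sup>T A u\<^sub>k\<close>. Expanding \<open>e\<^sub>k = \<parallel>A u\<^sub>k\<parallel>\<^sup>2\<close> and taking
  expectations over an event \<open>G\<close> of the past gives the basic inequality
  \<open>E[1\<^sub>G e\<^sub>k\<^sub>+\<^sub>1] \<le> E[1\<^sub>G e\<^sub>k] - 2 \<alpha> \<beta> E[1\<^sub>G g \<bullet> B g] + \<alpha>\<^sup>2 K E[1\<^sub>G (e\<^sub>k + 1)]\<close> (lemma \<open>expected_err_step\<close>).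

  The noise term is absorbed by passing from \<open>e\<^sub>k\<close> to \<open>V\<^sub>k = exp (K q\<^sub>k) (e\<^sub>k + K q\<^sub>k)\<close>, where \<open>q\<^sub>k\<close> is the tail
  of \<open>\<Sum> \<alpha>\<^sup>2\<close> from \<open>k\<close> on: \<open>V\<close> is a nonnegative supermartingale that moreover loses
  \<open>D\<^sub>k = 2 \<alpha> \<beta> g \<bullet> B g\<close> in each step (\<open>lyapunov_dissipation\<close>). Hence \<open>\<Sum> D\<^sub>k\<close> has finite expectation and converges almost surely (\<open>AE_summable_dissipation\<close>). As
  \<open>D\<^sub>k\<close> dominates a constant multiple of \<open>\<alpha> \<lambda>\<^sub>m\<^sub>i\<^sub>n(B) e\<^sub>k\<close> and \<open>\<Sum> \<alpha> \<lambda>\<^sub>m\<^sub>i\<^sub>n(B) = \<infinity>\<close>, the errors \<open>e\<^sub>k\<close> cannot stay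
  away from \<open>0\<close>, so \<open>V\<close> almost surely takes arbitrarily small values
  (\<open>err_small_infinitely_often\<close>).

  For a nonnegative supermartingale this already forces \<open>V\<^sub>k \<longlongrightarrow> 0\<close>: once \<open>V\<close> has dropped below \<open>\<epsilon>\<close>, the
  maximal inequality bounds the probability of ever climbing back to \<open>c\<close> by \<open>\<epsilon> / c\<close> (\<open>prob_exceed_after_small\<close>). This replaces the
  convergence theorem for nonnegative almost supermartingales by an elementary stopping argument, and
  conditional expectations never appear: integrals over events of the past carry the same information.

  Square integrability of the iterates follows by induction from the same independence, and \<open>E[S S]\<close> is
  positive definite because its quadratic form \<open>E[\<parallel>S v\<parallel>\<^sup>2]\<close> vanishes only if \<open>\<beta> v = E[S v] = 0\<close>.
\<close>

section \<open>Matrices and their norms\<close>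

text \<open>Adjoints are kept in the form \<open>transpose P *v v\<close>, which composes with the other matrix-vector products,
  instead of being rewritten to \<open>v v* P\<close>.\<close>

declare transpose_matrix_vector [simp del]

lemma bounded_bilinear_matrix_vector_mult:
  "bounded_bilinear ((*v) :: real ^ 'n ^ 'm \<Rightarrow> real ^ 'n \<Rightarrow> real ^ 'm)"
  unfolding bilinear_conv_bounded_bilinear[symmetric] bilinear_def
  by (auto intro!: linearI simp: algebra_simps scaleR_matrix_vector_assoc)

lemma bounded_bilinear_matrix_matrix_mult:
  "bounded_bilinear ((**) :: real ^ 'n ^ 'm \<Rightarrow> real ^ 'k ^ 'n \<Rightarrow> real ^ 'k ^ 'm)"
  unfolding bilinear_conv_bounded_bilinear[symmetric] bilinear_def
  by (auto intro!: linearI simp: vec_eq_iff matrix_matrix_mult_def sum.distrib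
      sum_distrib_left algebra_simps)

lemma bounded_linear_transpose: "bounded_linear (transpose :: real ^ 'n ^ 'm \<Rightarrow> real ^ 'm ^ 'n)"
  unfolding linear_conv_bounded_linear[symmetric]
  by (auto intro!: linearI simp: transpose_def vec_eq_iff)

lemma borel_measurable_vec_nth [measurable (raw)]:
  fixes f :: "'a \<Rightarrow> 'b :: topological_space ^ 'n"
  assumes "f \<in> borel_measurable M"
  shows "(\<lambda>\<omega>. f \<omega> $ i) \<in> borel_measurable M"
  by (rule measurable_compose[OF assms]) (intro borel_measurable_continuous_onI continuous_intros)

lemma borel_measurable_matrix_vector_mult [measurable (raw)]:
  fixes P :: "'a \<Rightarrow> real ^ 'n ^ 'm"
  assumes "P \<in> borel_measurable M" "v \<in> borel_measurable M"
  shows "(\<lambda>\<omega>. P \<omega> *v v \<omega>) \<in> borel_measurable M"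
  using assms
  by (rule borel_measurable_continuous_Pair)
    (intro bounded_bilinear.continuous_on[OF bounded_bilinear_matrix_vector_mult] continuous_intros)

lemma borel_measurable_matrix_matrix_mult [measurable (raw)]:
  fixes P :: "'a \<Rightarrow> real ^ 'n ^ 'm" and Q :: "'a \<Rightarrow> real ^ 'k ^ 'n"
  assumes "P \<in> borel_measurable M" "Q \<in> borel_measurable M"
  shows "(\<lambda>\<omega>. P \<omega> ** Q \<omega>) \<in> borel_measurable M"
  using assms
  by (rule borel_measurable_continuous_Pair)
    (intro bounded_bilinear.continuous_on[OF bounded_bilinear_matrix_matrix_mult] continuous_intros)

lemma borel_measurable_transpose [measurable (raw)]:
  fixes P :: "'a \<Rightarrow> real ^ 'n ^ 'm"
  assumes "P \<in> borel_measurable M"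
  shows "(\<lambda>\<omega>. transpose (P \<omega>)) \<in> borel_measurable M"
  using borel_measurable_continuous_onI[OF linear_continuous_on[OF bounded_linear_transpose]]
  by (rule measurable_compose[OF assms])

lemma norm_matrix_vector_mult_le_spectral_norm:
  fixes P :: "real ^ 'n ^ 'm"
  shows "norm (P *v v) \<le> spectral_norm P * norm v"
  unfolding spectral_norm_def by (intro onorm) simp

lemma spectral_norm_nonneg: "0 \<le> spectral_norm (P :: real ^ 'n ^ 'm)"
  unfolding spectral_norm_def by (intro onorm_pos_le) simp

text \<open>On matrices \<open>norm\<close> is the Frobenius norm. It is the convenient size for random matrices, being
  continuous and hence measurable; the next two lemmas relate it to the operator norm.\<close>

lemma norm_matrix_vector_mult_le:
  fixes P :: "real ^ 'n ^ 'm"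
  shows "norm (P *v v) \<le> norm P * norm v"
proof -
  have "norm (P *v v) = L2_set (\<lambda>i. \<bar>P $ i \<bullet> v\<bar>) UNIV"
    by (simp add: norm_vec_def matrix_vector_mul_component)
  also have "\<dots> \<le> L2_set (\<lambda>i. norm (P $ i) * norm v) UNIV"
    by (intro L2_set_mono) (auto simp: Cauchy_Schwarz_ineq2)
  also have "\<dots> = norm P * norm v"
    by (simp add: norm_vec_def L2_set_left_distrib)
  finally show ?thesis .
qed

lemma norm_le_spectral_norm:
  fixes P :: "real ^ 'n ^ 'm"
  shows "norm P \<le> CARD('m) * CARD('n) * spectral_norm P"
proof -
  have "norm P \<le> (\<Sum>i\<in>UNIV. norm (P $ i))"
    unfolding norm_vec_def[of P] by (intro L2_set_le_sum) simp
  also have "\<dots> \<le> (\<Sum>i\<in>(UNIV :: 'm set). \<Sum>j\<in>(UNIV :: 'n set). spectral_norm P)"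
    unfolding spectral_norm_def
    by (intro sum_mono order_trans[OF norm_le_l1_cart] matrix_component_le_onorm)
  finally show ?thesis by (simp add: ac_simps)
qed

text \<open>With \<open>c = \<parallel>P\<parallel>\<close> the matrix \<open>Q = c I - P\<close> is positive semidefinite, so the eigenvalue \<open>\<plusminus>\<parallel>Q\<parallel>\<close> that every
  symmetric matrix has must be \<open>+\<parallel>Q\<parallel>\<close>. Then \<open>c - \<parallel>Q\<parallel>\<close> is an eigenvalue of \<open>P\<close>, and it bounds the
  quadratic form of \<open>P\<close> from below because \<open>v \<bullet> Q v \<le> \<parallel>Q\<parallel> \<parallel>v\<parallel>\<^sup>2\<close>.\<close>

lemma lambda_min_le_rayleigh:
  fixes P :: "real ^ 'n ^ 'n"
  assumes sym: "transpose P = P"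
  shows "lambda_min P * (norm v)\<^sup>2 \<le> v \<bullet> (P *v v)"
proof -
  define c where "c = spectral_norm P"
  define Q where "Q = c *\<^sub>R mat 1 - P"
  define t where "t = spectral_norm Q"
  have Q: "Q *v w = c *\<^sub>R w - P *v w" for w
    by (simp add: Q_def matrix_vector_mult_diff_rdistrib scaleR_matrix_vector_assoc[symmetric])
  have psd: "0 \<le> w \<bullet> (Q *v w)" for w
  proof -
    have "w \<bullet> (P *v w) \<le> norm w * (c * norm w)"
      unfolding c_def
      by (intro order_trans[OF norm_cauchy_schwarz] mult_left_mono
          norm_matrix_vector_mult_le_spectral_norm) simp
    then show ?thesis
      by (simp add: Q inner_diff_right dot_square_norm power2_eq_square algebra_simps)
  qed
  have symQ: "transpose Q = Q"
    using sym by (simp add: Q_def linear_diff[OF bounded_linear.linear[OF bounded_linear_transpose]]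
        transpose_scalar)
  have "t \<in> eigenvalues Q"
  proof -
    \<comment> \<open>\<open>-t\<close> can only be an eigenvalue of the semidefinite \<open>Q\<close> in the degenerate case \<open>Q = 0\<close>.\<close>
    have "t = 0" if "- t \<in> eigenvalues Q"
    proof -
      obtain w where w: "w \<noteq> 0" "Q *v w = - t *\<^sub>R w"
        using \<open>- t \<in> eigenvalues Q\<close> by (auto simp: eigenvalues_def)
      then have "t * (w \<bullet> w) \<le> 0" using psd[of w] by simp
      then have "t \<le> 0" using inner_gt_zero_iff w(1) by (metis mult_le_0_iff not_le)
      then show ?thesis using spectral_norm_nonneg[of Q] by (simp add: t_def)
    qed
    then show ?thesis using spectral_norm_eigenvalue[OF symQ] by (auto simp: t_def)
  qed
  then have "c - t \<in> eigenvalues P"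
    by (auto simp: eigenvalues_def Q algebra_simps)
  then have "lambda_min P \<le> c - t"
    unfolding lambda_min_def using finite_eigenvalues[OF sym] by (rule Min_le[rotated])
  then have "lambda_min P * (norm v)\<^sup>2 \<le> (c - t) * (norm v)\<^sup>2"
    by (intro mult_right_mono) auto
  also have "\<dots> \<le> v \<bullet> (P *v v)"
  proof -
    have "v \<bullet> (Q *v v) \<le> norm v * (t * norm v)"
      unfolding t_def
      by (intro order_trans[OF norm_cauchy_schwarz] mult_left_mono
          norm_matrix_vector_mult_le_spectral_norm) simp
    then show ?thesis
      by (simp add: Q inner_diff_right dot_square_norm power2_eq_square algebra_simps)
  qed
  finally show ?thesis .
qed

lemma lambda_min_pos:
  fixes P :: "real ^ 'n ^ 'n"
  assumes "sym_pos_def P"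
  shows "0 < lambda_min P"
proof -
  have sym: "transpose P = P" using assms by (simp add: sym_pos_def_def)
  have "lambda_min P \<in> eigenvalues P"
    unfolding lambda_min_def
    by (intro Min_in finite_eigenvalues eigenvalues_nonempty sym)
  then obtain v where v: "v \<noteq> 0" "P *v v = lambda_min P *\<^sub>R v"
    by (auto simp: eigenvalues_def)
  then have "0 < lambda_min P * (v \<bullet> v)" "0 < v \<bullet> v"
    using assms by (force simp: sym_pos_def_def)+
  then show ?thesis by (rule zero_less_mult_pos2)
qed

lemma inner_matrix_vector_adjoint:
  fixes P :: "real ^ 'n ^ 'm"
  shows "v \<bullet> (P *v w) = (transpose P *v v) \<bullet> w"
  by (simp add: transpose_matrix_vector dot_lmul_matrix)

lemma full_rank_gram_invertible:
  fixes A :: "real ^ 'n ^ 'm"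
  assumes "rank A = CARD('n)"
  shows "invertible (transpose A ** A)"
proof -
  have inj: "inj ((*v) A)" using assms by (simp add: full_rank_injective)
  have "v = 0" if "(transpose A ** A) *v v = 0" for v
  proof -
    have "(A *v v) \<bullet> (A *v v) = v \<bullet> ((transpose A ** A) *v v)"
      by (simp add: inner_matrix_vector_adjoint[of _ A] inner_commute[of v]
          matrix_vector_mul_assoc[symmetric])
    then have "A *v v = A *v 0" using that by simp
    then show ?thesis by (rule injD[OF inj])
  qed
  then show ?thesis
    unfolding invertible_left_inverse matrix_left_invertible_ker by blast
qed

lemma matrix_inv_mult:
  fixes P :: "real ^ 'n ^ 'n"
  assumes "invertible P"
  shows "P ** matrix_inv P = mat 1" "matrix_inv P ** P = mat 1"
  using someI_ex[OF assms[unfolded invertible_def]] by (simp_all add: matrix_inv_def)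

lemma least_squares_residual:
  fixes A :: "real ^ 'n ^ 'm"
  assumes "invertible (transpose A ** A)"
    and "xhat = matrix_inv (transpose A ** A) *v (transpose A *v b)"
  shows "transpose A *v (b - A *v xhat) = 0"
proof -
  have "transpose A *v (A *v xhat) = transpose A *v b"
    unfolding assms(2) matrix_vector_mul_assoc[of "transpose A" A]
    by (simp only: matrix_vector_mul_assoc[of "transpose A ** A"] matrix_inv_mult(1)[OF assms(1)]
        matrix_vector_mul_lid)
  then show ?thesis by (simp only: matrix_vector_mult_diff_distrib) simp
qed

section \<open>Dissipative nonnegative supermartingales\<close>

locale filtered_prob_space = prob_space M
  for M :: "'a measure" +
  fixes F :: "nat \<Rightarrow> 'a measure"
  assumes subalgebra: "\<And>k. subalgebra M (F k)"
    and filtration: "\<And>k. sets (F k) \<subseteq> sets (F (Suc k))"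
begin

lemma space_F: "space (F k) = space M"
  using subalgebra[of k] by (simp add: subalgebra_def)

lemma sets_F_subset: "G \<in> sets (F k) \<Longrightarrow> G \<in> sets M"
  using subalgebra[of k] by (auto simp: subalgebra_def)

lemma filtration_mono: "i \<le> k \<Longrightarrow> sets (F i) \<subseteq> sets (F k)"
  by (rule lift_Suc_mono_le[of "\<lambda>k. sets (F k)"]) (rule filtration)

lemma measurable_later: "f \<in> borel_measurable (F k) \<Longrightarrow> f \<in> borel_measurable (F (Suc k))"
  by (rule measurable_from_subalg[rotated])
    (use filtration[of k] in \<open>auto simp: subalgebra_def space_F\<close>)

lemmas adapted_measurable = measurable_from_subalg[OF subalgebra]

end

text \<open>The last assumption is the integrated form of \<open>E[V\<^sub>k\<^sub>+\<^sub>1 | F\<^sub>k] \<le> V\<^sub>k - D\<^sub>k\<close>, where \<open>D\<^sub>k\<close> is the amount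
  lost in step \<open>k\<close>.\<close>

locale dissipative_process = filtered_prob_space M F
  for M :: "'a measure" and F +
  fixes V D :: "nat \<Rightarrow> 'a \<Rightarrow> real"
  assumes adapted: "\<And>k. V k \<in> borel_measurable (F k)"
    and V_integrable: "\<And>k. integrable M (V k)"
    and D_integrable: "\<And>k. integrable M (D k)"
    and V_nonneg: "\<And>k \<omega>. \<omega> \<in> space M \<Longrightarrow> 0 \<le> V k \<omega>"
    and D_nonneg: "\<And>k \<omega>. \<omega> \<in> space M \<Longrightarrow> 0 \<le> D k \<omega>"
    and dissipation: "\<And>k G. G \<in> sets (F k) \<Longrightarrow>
      (\<integral>\<omega>. indicator G \<omega> * V (Suc k) \<omega> \<partial>M) + (\<integral>\<omega>. indicator G \<omega> * D k \<omega> \<partial>M)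
        \<le> (\<integral>\<omega>. indicator G \<omega> * V k \<omega> \<partial>M)"
begin

lemma V_measurable [measurable]: "V k \<in> borel_measurable M"
  using V_integrable by (rule borel_measurable_integrable)

lemma V_less_event: "{\<omega> \<in> space M. V i \<omega> < c} \<in> sets (F i)"
  and V_ge_event: "{\<omega> \<in> space M. c \<le> V i \<omega>} \<in> sets (F i)"
  using adapted[of i] by (simp_all add: space_F[of i, symmetric])

lemma integrable_indicator_V:
  "G \<in> sets M \<Longrightarrow> integrable M (\<lambda>\<omega>. indicator G \<omega> * V k \<omega>)"
  using integrable_real_mult_indicator[OF _ V_integrable] by (simp add: mult.commute)

lemma integrable_indicator_const:
  "G \<in> sets M \<Longrightarrow> integrable M (\<lambda>\<omega>. indicator G \<omega> * (c :: real))"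
  by (intro integrable_mult_left integrable_real_indicator) (auto simp: less_top[symmetric])

lemma supermartingale_step:
  assumes "G \<in> sets (F k)"
  shows "(\<integral>\<omega>. indicator G \<omega> * V (Suc k) \<omega> \<partial>M) \<le> (\<integral>\<omega>. indicator G \<omega> * V k \<omega> \<partial>M)"
proof -
  have "0 \<le> (\<integral>\<omega>. indicator G \<omega> * D k \<omega> \<partial>M)"
    by (intro integral_nonneg_AE AE_I2) (simp add: D_nonneg)
  then show ?thesis using dissipation[OF assms] by linarith
qed

lemma markov_on_event:
  assumes G: "G \<in> sets M" and above: "\<And>\<omega>. \<omega> \<in> G \<Longrightarrow> c \<le> V k \<omega>"
  shows "c * prob G \<le> (\<integral>\<omega>. indicator G \<omega> * V k \<omega> \<partial>M)"
proof -
  have "c * prob G = (\<integral>\<omega>. indicator G \<omega> * c \<partial>M)"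
    using G by (simp add: Int_absorb2[OF sets.sets_into_space])
  also have "\<dots> \<le> (\<integral>\<omega>. indicator G \<omega> * V k \<omega> \<partial>M)"
    using above
    by (intro integral_mono integrable_indicator_V integrable_indicator_const G)
      (auto simp: indicator_def)
  finally show ?thesis .
qed

text \<open>Doob's maximal inequality, localised to an event of the past. Split \<open>G\<close> according to whether \<open>V\<^sub>k\<close> has
  already reached the level \<open>c\<close>: on the part where it has, Markov's inequality applies; the other part is
  an event of the next \<open>\<sigma>\<close>-algebra, where the induction hypothesis applies and the expectation of \<open>V\<close> has
  not grown. The induction therefore has to range over all events \<open>G\<close> and starting times \<open>k\<close>.\<close>

lemma maximal_inequality:
  assumes "G \<in> sets (F k)"
  shows "c * prob (G \<inter> {\<omega> \<in> space M. \<exists>j\<in>{k..k + n}. c \<le> V j \<omega>})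
    \<le> (\<integral>\<omega>. indicator G \<omega> * V k \<omega> \<partial>M)"
  using assms
proof (induction n arbitrary: k G)
  case 0
  have "G \<inter> {\<omega> \<in> space M. c \<le> V k \<omega>} \<in> sets (F k)"
    using 0 V_ge_event by blast
  then have G: "G \<inter> {\<omega> \<in> space M. c \<le> V k \<omega>} \<in> sets M" (is "?G \<in> _")
    by (rule sets_F_subset)
  have "c * prob ?G \<le> (\<integral>\<omega>. indicator ?G \<omega> * V k \<omega> \<partial>M)"
    by (rule markov_on_event[OF G]) auto
  also have "\<dots> \<le> (\<integral>\<omega>. indicator G \<omega> * V k \<omega> \<partial>M)"
    using V_nonneg
    by (intro integral_mono integrable_indicator_V G sets_F_subset[OF 0])
      (auto simp: indicator_def)
  finally show ?case by simp
next
  case (Suc n)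
  define H where "H = G \<inter> {\<omega> \<in> space M. c \<le> V k \<omega>}"
  define L where "L = G \<inter> {\<omega> \<in> space M. V k \<omega> < c}"
  have HF: "H \<in> sets (F k)" and LF: "L \<in> sets (F k)"
    using Suc.prems V_ge_event V_less_event unfolding H_def L_def by blast+
  then have HM: "H \<in> sets M" and LM: "L \<in> sets M" by (auto dest: sets_F_subset)
  have GM: "G \<in> sets M" using Suc.prems by (rule sets_F_subset)
  define E where "E = L \<inter> {\<omega> \<in> space M. \<exists>j\<in>{Suc k..Suc k + n}. c \<le> V j \<omega>}"
  have EM: "E \<in> sets M" unfolding E_def using LM by measurable
  have "{k..k + Suc n} = insert k {Suc k..Suc k + n}" by auto
  then have "G \<inter> {\<omega> \<in> space M. \<exists>j\<in>{k..k + Suc n}. c \<le> V j \<omega>} = H \<union> E"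
    by (auto simp: H_def L_def E_def)
  moreover have "H \<inter> E = {}" by (auto simp: H_def L_def E_def)
  ultimately have "c * prob (G \<inter> {\<omega> \<in> space M. \<exists>j\<in>{k..k + Suc n}. c \<le> V j \<omega>})
      = c * prob H + c * prob E"
    using HM EM by (simp add: finite_measure_Union algebra_simps)
  also have "c * prob H \<le> (\<integral>\<omega>. indicator H \<omega> * V k \<omega> \<partial>M)"
    by (rule markov_on_event[OF HM]) (auto simp: H_def)
  also have "c * prob E \<le> (\<integral>\<omega>. indicator L \<omega> * V (Suc k) \<omega> \<partial>M)"
    unfolding E_def using LF filtration by (intro Suc.IH) blast
  also have "\<dots> \<le> (\<integral>\<omega>. indicator L \<omega> * V k \<omega> \<partial>M)"
    by (rule supermartingale_step[OF LF])
  also have "(\<integral>\<omega>. indicator H \<omega> * V k \<omega> \<partial>M) + (\<integral>\<omega>. indicator L \<omega> * V k \<omega> \<partial>M)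
      = (\<integral>\<omega>. indicator H \<omega> * V k \<omega> + indicator L \<omega> * V k \<omega> \<partial>M)"
    by (intro Bochner_Integration.integral_add[symmetric] integrable_indicator_V HM LM)
  also have "\<dots> = (\<integral>\<omega>. indicator G \<omega> * V k \<omega> \<partial>M)"
    by (intro Bochner_Integration.integral_cong) (auto simp: H_def L_def indicator_def)
  finally show ?case by simp
qed

text \<open>Decompose the space by the first time \<open>k\<close> at which \<open>V\<^sub>k < \<epsilon>\<close>. The piece \<open>G\<^sub>k\<close> belongs to time \<open>k\<close> and
  \<open>V\<^sub>k < \<epsilon>\<close> on it, so by the maximal inequality at most the fraction \<open>\<epsilon> / c\<close> of \<open>G\<^sub>k\<close> sees \<open>V\<close>
  climb to \<open>c\<close> later on. Summing over \<open>k\<close> gives the claim.\<close>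

lemma prob_exceed_after_small:
  assumes small: "AE \<omega> in M. \<exists>k. V k \<omega> < \<epsilon>" and "0 < c" "0 < \<epsilon>"
  shows "c * prob {\<omega> \<in> space M. \<forall>n. \<exists>j\<ge>n. c \<le> V j \<omega>} \<le> \<epsilon>"
proof -
  define L where "L = {\<omega> \<in> space M. \<forall>n. \<exists>j\<ge>n. c \<le> V j \<omega>}"
  have LM: "L \<in> sets M" unfolding L_def by measurable
  define G where "G k = {\<omega> \<in> space M. V k \<omega> < \<epsilon> \<and> (\<forall>i<k. \<epsilon> \<le> V i \<omega>)}" for k
  have GF: "G k \<in> sets (F k)" for k
  proof -
    have "{\<omega> \<in> space M. \<epsilon> \<le> V i \<omega>} \<in> sets (F k)" if "i < k" for i
      using V_ge_event filtration_mono[of i k] that by auto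
    then have "{\<omega> \<in> space (F k). V k \<omega> < \<epsilon> \<and> (\<forall>i\<in>{..<k}. \<epsilon> \<le> V i \<omega>)} \<in> sets (F k)"
      by (intro sets.sets_Collect_conj sets.sets_Collect_finite_All)
        (use V_less_event in \<open>auto simp: space_F\<close>)
    then show ?thesis by (simp add: G_def space_F Ball_def)
  qed
  have GM: "G k \<in> sets M" for k using GF by (rule sets_F_subset)
  have disj: "disjoint_family G"
    unfolding disjoint_family_on_def
  proof (intro ballI impI)
    have "G i \<inter> G k = {}" if "i < k" for i k
      using that by (force simp: G_def)
    then show "G i \<inter> G k = {}" if "i \<noteq> k" for i k
      using that by (metis Int_commute linorder_neqE_nat)
  qed
  have piece: "c * prob (L \<inter> G k) \<le> \<epsilon> * prob (G k)" for k
  proof -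
    define E where "E n = G k \<inter> {\<omega> \<in> space M. \<exists>j\<in>{k..k + n}. c \<le> V j \<omega>}" for n
    have EM: "E n \<in> sets M" for n unfolding E_def using GM by measurable
    have inc: "incseq E" unfolding E_def incseq_def by fastforce
    have "(\<lambda>n. c * prob (E n)) \<longlonglongrightarrow> c * prob (\<Union>n. E n)"
      using EM inc by (intro tendsto_mult_left finite_Lim_measure_incseq) auto
    moreover have "c * prob (E n) \<le> \<epsilon> * prob (G k)" for n
    proof -
      have "c * prob (E n) \<le> (\<integral>\<omega>. indicator (G k) \<omega> * V k \<omega> \<partial>M)"
        unfolding E_def by (rule maximal_inequality[OF GF])
      also have "\<dots> \<le> (\<integral>\<omega>. indicator (G k) \<omega> * \<epsilon> \<partial>M)"
        by (intro integral_mono integrable_indicator_V integrable_indicator_const GM)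
          (auto simp: indicator_def G_def)
      also have "\<dots> = \<epsilon> * prob (G k)"
        using GM by (simp add: Int_absorb2[OF sets.sets_into_space])
      finally show ?thesis .
    qed
    ultimately have le: "c * prob (\<Union>n. E n) \<le> \<epsilon> * prob (G k)"
      by (intro LIMSEQ_le_const2) auto
    have "L \<inter> G k \<subseteq> (\<Union>n. E n)"
    proof
      fix \<omega> assume \<omega>: "\<omega> \<in> L \<inter> G k"
      then obtain j where "k \<le> j" "c \<le> V j \<omega>" by (auto simp: L_def)
      then have "\<omega> \<in> E (j - k)" using \<omega> by (auto simp: E_def L_def intro!: bexI[of _ j])
      then show "\<omega> \<in> (\<Union>n. E n)" by blast
    qed
    then have "prob (L \<inter> G k) \<le> prob (\<Union>n. E n)"
      using EM by (intro finite_measure_mono) auto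
    then show ?thesis using le \<open>0 < c\<close> by (smt (verit) mult_left_mono)
  qed
  have "AE \<omega> in M. \<omega> \<in> (\<Union>k. G k)"
    using small AE_space
  proof eventually_elim
    case (elim \<omega>)
    then have "V (LEAST k. V k \<omega> < \<epsilon>) \<omega> < \<epsilon>" by (auto intro: LeastI_ex)
    then have "\<omega> \<in> G (LEAST k. V k \<omega> < \<epsilon>)"
      using elim(2) by (auto simp: G_def dest: not_less_Least simp: not_less[symmetric])
    then show ?case by blast
  qed
  then have "prob L = prob (\<Union>k. L \<inter> G k)"
    using LM GM by (intro finite_measure_eq_AE) auto
  moreover have "(\<lambda>k. prob (L \<inter> G k)) sums prob (\<Union>k. L \<inter> G k)"
    using LM GM disj by (intro finite_measure_UNION) (auto simp: disjoint_family_on_def)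
  ultimately have "(\<lambda>k. c * prob (L \<inter> G k)) sums (c * prob L)"
    by (simp add: sums_mult)
  moreover have "(\<lambda>k. \<epsilon> * prob (G k)) sums (\<epsilon> * prob (\<Union>k. G k))"
    using GM disj by (intro sums_mult finite_measure_UNION) auto
  ultimately have "c * prob L \<le> \<epsilon> * prob (\<Union>k. G k)"
    by (rule sums_le[OF piece])
  also have "\<dots> \<le> \<epsilon>" using \<open>0 < \<epsilon>\<close> prob_le_1 by (intro mult_left_le) auto
  finally show ?thesis by (simp add: L_def)
qed

lemma AE_tendsto_zero_of_small:
  assumes small: "AE \<omega> in M. \<forall>\<epsilon>>0. \<exists>k. V k \<omega> < \<epsilon>"
  shows "AE \<omega> in M. (\<lambda>k. V k \<omega>) \<longlonglongrightarrow> 0"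
proof -
  have "AE \<omega> in M. \<not> (\<forall>n. \<exists>j\<ge>n. c \<le> V j \<omega>)" if "0 < c" for c
  proof -
    let ?L = "{\<omega> \<in> space M. \<forall>n. \<exists>j\<ge>n. c \<le> V j \<omega>}"
    have "c * prob ?L \<le> 0"
    proof (rule field_le_epsilon)
      fix \<epsilon> :: real assume "0 < \<epsilon>"
      moreover have "AE \<omega> in M. \<exists>k. V k \<omega> < \<epsilon>"
        using small by eventually_elim (use \<open>0 < \<epsilon>\<close> in blast)
      ultimately show "c * prob ?L \<le> 0 + \<epsilon>"
        using prob_exceed_after_small[of \<epsilon> c] that by simp
    qed
    then have "prob ?L = 0" using that by (simp add: mult_le_0_iff measure_le_0_iff)
    then show ?thesis
      by (subst (asm) prob_eq_0) auto
  qed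
  then have "AE \<omega> in M. \<forall>m. \<not> (\<forall>n. \<exists>j\<ge>n. 1 / real (Suc m) \<le> V j \<omega>)"
    unfolding AE_all_countable by simp
  then show ?thesis
    using AE_space
  proof eventually_elim
    case (elim \<omega>)
    show ?case
    proof (rule LIMSEQ_I)
      fix r :: real assume "0 < r"
      then obtain m where m: "1 / real (Suc m) < r" using nat_approx_posE by blast
      obtain n where "\<forall>j\<ge>n. V j \<omega> < 1 / real (Suc m)"
        using elim(1) by (meson not_less)
      then show "\<exists>n. \<forall>j\<ge>n. norm (V j \<omega> - 0) < r"
        using m V_nonneg[OF elim(2)] by (intro exI[of _ n]) (auto intro: less_trans)
    qed
  qed
qed

text \<open>The losses telescope: their expectations add up to at most \<open>E[V\<^sub>0]\<close>, so their sum is finite almost surely.\<close>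

lemma AE_summable_dissipation: "AE \<omega> in M. summable (\<lambda>k. D k \<omega>)"
proof -
  have sumD: "(\<Sum>k<n. \<integral>\<omega>. D k \<omega> \<partial>M) + (\<integral>\<omega>. V n \<omega> \<partial>M) \<le> (\<integral>\<omega>. V 0 \<omega> \<partial>M)" for n
  proof (induction n)
    case (Suc n)
    have "(\<integral>\<omega>. indicator (space M) \<omega> * f \<omega> \<partial>M) = (\<integral>\<omega>. f \<omega> \<partial>M)" for f :: "'a \<Rightarrow> real"
      by (intro Bochner_Integration.integral_cong) auto
    moreover have "space M \<in> sets (F n)" using sets.top[of "F n"] by (simp add: space_F)
    ultimately show ?case using dissipation[of "space M" n] Suc by simp
  qed simp
  have "(\<Sum>k<n. \<integral>\<omega>. norm (D k \<omega>) \<partial>M) \<le> (\<integral>\<omega>. V 0 \<omega> \<partial>M)" for n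
  proof -
    have "(\<integral>\<omega>. norm (D k \<omega>) \<partial>M) = (\<integral>\<omega>. D k \<omega> \<partial>M)" for k
      by (intro Bochner_Integration.integral_cong) (auto simp: D_nonneg)
    moreover have "0 \<le> (\<integral>\<omega>. V n \<omega> \<partial>M)"
      by (intro integral_nonneg_AE AE_I2 V_nonneg)
    ultimately show ?thesis using sumD[of n] by simp
  qed
  then have "summable (\<lambda>k. \<integral>\<omega>. norm (D k \<omega>) \<partial>M)"
    by (intro bounded_imp_summable[of _ "\<integral>\<omega>. V 0 \<omega> \<partial>M"] integral_nonneg_AE)
      (simp_all only: lessThan_Suc_atMost[symmetric] norm_ge_zero AE_I2)
  then have fin: "(\<Sum>k. ennreal (\<integral>\<omega>. norm (D k \<omega>) \<partial>M)) < \<infinity>"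
    by (subst suminf_ennreal2) auto
  have "(\<integral>\<^sup>+\<omega>. (\<Sum>k. ennreal (D k \<omega>)) \<partial>M) = (\<Sum>k. \<integral>\<^sup>+\<omega>. ennreal (D k \<omega>) \<partial>M)"
    using borel_measurable_integrable[OF D_integrable] by (intro nn_integral_suminf) measurable
  also have "\<dots> = (\<Sum>k. ennreal (\<integral>\<omega>. norm (D k \<omega>) \<partial>M))"
  proof (intro suminf_cong)
    fix k
    have "(\<integral>\<^sup>+\<omega>. ennreal (D k \<omega>) \<partial>M) = (\<integral>\<^sup>+\<omega>. ennreal (norm (D k \<omega>)) \<partial>M)"
      by (intro nn_integral_cong) (simp add: D_nonneg)
    also have "\<dots> = ennreal (\<integral>\<omega>. norm (D k \<omega>) \<partial>M)"
      using D_integrable by (intro nn_integral_eq_integral) auto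
    finally show "(\<integral>\<^sup>+\<omega>. ennreal (D k \<omega>) \<partial>M) = ennreal (\<integral>\<omega>. norm (D k \<omega>) \<partial>M)" .
  qed
  finally have "(\<integral>\<^sup>+\<omega>. (\<Sum>k. ennreal (D k \<omega>)) \<partial>M) \<noteq> \<infinity>" using fin by simp
  then have "AE \<omega> in M. (\<Sum>k. ennreal (D k \<omega>)) \<noteq> \<infinity>"
    using borel_measurable_integrable[OF D_integrable]
    by (intro nn_integral_PInf_AE) measurable
  then show ?thesis
    using AE_space
  proof eventually_elim
    case (elim \<omega>)
    then show ?case using D_nonneg by (intro summable_suminf_not_top) auto
  qed
qed

theorem AE_tendsto_zero:
  assumes "AE \<omega> in M. summable (\<lambda>k. D k \<omega>) \<longrightarrow> (\<forall>\<epsilon>>0. \<exists>k. V k \<omega> < \<epsilon>)"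
  shows "AE \<omega> in M. (\<lambda>k. V k \<omega>) \<longlonglongrightarrow> 0"
  using assms AE_summable_dissipation by (intro AE_tendsto_zero_of_small) auto

end

section \<open>Expectations of products with an independent factor\<close>

context prob_space
begin

lemma integral_mult_indep:
  fixes Y :: "'a \<Rightarrow> real" and S :: "'a \<Rightarrow> 'b :: topological_space" and h :: "'b \<Rightarrow> real"
  assumes F: "subalgebra M F"
    and indep: "indep_set (sets F) (sets (vimage_algebra (space M) S borel))"
    and S: "S \<in> borel_measurable M" and h: "h \<in> borel_measurable borel"
    and Y: "Y \<in> borel_measurable F" "integrable M Y"
    and int: "integrable M (\<lambda>\<omega>. h (S \<omega>))"
  shows "integrable M (\<lambda>\<omega>. Y \<omega> * h (S \<omega>))"
    and "(\<integral>\<omega>. Y \<omega> * h (S \<omega>) \<partial>M) = (\<integral>\<omega>. Y \<omega> \<partial>M) * (\<integral>\<omega>. h (S \<omega>) \<partial>M)"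
proof -
  have spF: "space F = space M" using F by (simp add: subalgebra_def)
  have "sigma_sets (space M) {Y -` A \<inter> space M | A. A \<in> sets borel} \<subseteq> sets F"
    unfolding spF[symmetric] using measurable_sets[OF Y(1)]
    by (intro sets.sigma_sets_subset) auto
  moreover have "sigma_sets (space M) {(\<lambda>\<omega>. h (S \<omega>)) -` A \<inter> space M | A. A \<in> sets borel}
      \<subseteq> sets (vimage_algebra (space M) S borel)"
  proof -
    let ?N = "vimage_algebra (space M) S borel"
    have "S \<in> measurable ?N borel" by (intro measurable_vimage_algebra1) simp
    then have "(\<lambda>\<omega>. h (S \<omega>)) \<in> borel_measurable ?N" using h by (rule measurable_compose)
    then have "{(\<lambda>\<omega>. h (S \<omega>)) -` A \<inter> space M | A. A \<in> sets borel} \<subseteq> sets ?N"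
      by (auto dest: measurable_sets)
    then show ?thesis
      using sets.sigma_sets_subset[of _ ?N] by simp
  qed
  ultimately have "indep_var borel Y borel (\<lambda>\<omega>. h (S \<omega>))"
    using indep borel_measurable_integrable[OF Y(2)] borel_measurable_integrable[OF int]
    unfolding indep_var_eq indep_sets2_eq by blast
  then show "integrable M (\<lambda>\<omega>. Y \<omega> * h (S \<omega>))"
    and "(\<integral>\<omega>. Y \<omega> * h (S \<omega>) \<partial>M) = (\<integral>\<omega>. Y \<omega> \<partial>M) * (\<integral>\<omega>. h (S \<omega>) \<partial>M)"
    using Y(2) int by (auto intro: indep_var_integrable indep_var_lebesgue_integral)
qed

text \<open>A random matrix that is independent of the past may be replaced by its mean inside a bilinear form of
  past vectors. The form is a finite sum of products \<open>p\<^sub>i q\<^sub>j S\<^sub>i\<^sub>j\<close>, and in each of them the factor \<open>S\<^sub>i\<^sub>j\<close> is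
  independent of the rest; this is also why integrability is only required of the products \<open>p\<^sub>i q\<^sub>j\<close>.\<close>

lemma integral_bilinear_indep:
  fixes S :: "'a \<Rightarrow> real ^ 'n ^ 'm"
  assumes F: "subalgebra M F"
    and indep: "indep_set (sets F) (sets (vimage_algebra (space M) S borel))"
    and mean: "has_bochner_integral M S Q"
    and p: "p \<in> borel_measurable F" and q: "q \<in> borel_measurable F"
    and int: "\<And>i j. integrable M (\<lambda>\<omega>. p \<omega> $ i * q \<omega> $ j)"
  shows "has_bochner_integral M (\<lambda>\<omega>. p \<omega> \<bullet> (S \<omega> *v q \<omega>)) (\<integral>\<omega>. p \<omega> \<bullet> (Q *v q \<omega>) \<partial>M)"
proof -
  have expand: "v \<bullet> (P *v w) = (\<Sum>i\<in>UNIV. \<Sum>j\<in>UNIV. v $ i * w $ j * P $ i $ j)"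
    for v and P :: "real ^ 'n ^ 'm" and w
    by (simp add: inner_vec_def matrix_vector_mult_def sum_distrib_left ac_simps)
  have S: "S \<in> borel_measurable M"
    using mean by (rule borel_measurable_has_bochner_integral)
  have entry: "has_bochner_integral M (\<lambda>\<omega>. S \<omega> $ i $ j) (Q $ i $ j)" for i j
    by (intro has_bochner_integral_bounded_linear[OF bounded_linear_vec_nth] mean)
  have "has_bochner_integral M (\<lambda>\<omega>. p \<omega> $ i * q \<omega> $ j * S \<omega> $ i $ j)
      (\<integral>\<omega>. p \<omega> $ i * q \<omega> $ j * Q $ i $ j \<partial>M)" for i j
  proof -
    have meas: "(\<lambda>P :: real ^ 'n ^ 'm. P $ i $ j) \<in> borel_measurable borel"
      by measurable
    have pq: "(\<lambda>\<omega>. p \<omega> $ i * q \<omega> $ j) \<in> borel_measurable F"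
      using p q by measurable
    have ent: "integrable M (\<lambda>\<omega>. S \<omega> $ i $ j)" "(\<integral>\<omega>. S \<omega> $ i $ j \<partial>M) = Q $ i $ j"
      using entry[of i j] by (auto simp: has_bochner_integral_iff)
    show ?thesis
      using integral_mult_indep[OF F indep S meas pq int ent(1)]
      by (simp add: has_bochner_integral_iff ent(2))
  qed
  then have "has_bochner_integral M (\<lambda>\<omega>. p \<omega> \<bullet> (S \<omega> *v q \<omega>))
      (\<Sum>i\<in>UNIV. \<Sum>j\<in>UNIV. \<integral>\<omega>. p \<omega> $ i * q \<omega> $ j * Q $ i $ j \<partial>M)"
    unfolding expand by (intro has_bochner_integral_sum)
  also have "(\<Sum>i\<in>UNIV. \<Sum>j\<in>UNIV. \<integral>\<omega>. p \<omega> $ i * q \<omega> $ j * Q $ i $ j \<partial>M)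
      = (\<integral>\<omega>. p \<omega> \<bullet> (Q *v q \<omega>) \<partial>M)"
    unfolding expand using int by (simp add: Bochner_Integration.integral_sum)
  finally show ?thesis .
qed

end

section \<open>Preconditioned gradient descent with random sketches\<close>

lemma norm_diff_squared_le:
  fixes v w :: "'b :: real_inner"
  shows "(norm (v - w))\<^sup>2 \<le> 2 * (norm v)\<^sup>2 + 2 * (norm w)\<^sup>2"
  using zero_le_power2[of "norm (v + w)"]
  unfolding power2_norm_eq_inner by (simp add: inner_commute algebra_simps)

text \<open>The recursion for the error vector \<open>u\<^sub>k = x\<^sub>k - xhat\<close>, where \<open>r\<close> is the residual of the least-squares
  solution and \<open>F k\<close> is the history up to time \<open>k\<close>. Thus \<open>u k\<close> and \<open>B k\<close> are known at time \<open>k\<close>, and the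
  sketch \<open>S k\<close> is drawn afterwards.\<close>

locale sketched_gradient_descent = filtered_prob_space M F
  for M :: "'a measure" and F +
  fixes A :: "real ^ 'n ^ 'm" and r :: "real ^ 'm"
    and S :: "nat \<Rightarrow> 'a \<Rightarrow> real ^ 'm ^ 'm"
    and B :: "nat \<Rightarrow> 'a \<Rightarrow> real ^ 'n ^ 'n"
    and \<alpha> :: "nat \<Rightarrow> real" and \<beta> Bmax \<mu> :: real
    and u :: "nat \<Rightarrow> 'a \<Rightarrow> real ^ 'n"
  assumes S_measurable: "\<And>k. S k \<in> borel_measurable (F (Suc k))"
    and S_indep: "\<And>k. indep_set (sets (F k)) (sets (vimage_algebra (space M) (S k) borel))"
    and S_mean: "\<And>k. has_bochner_integral M (S k) (\<beta> *\<^sub>R mat 1)"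
    and S_second_moment: "\<And>k. has_bochner_integral M (\<lambda>\<omega>. (norm (S k \<omega>))\<^sup>2) \<mu>"
    and B_measurable: "\<And>k. B k \<in> borel_measurable (F k)"
    and B_spd: "\<And>k \<omega>. \<omega> \<in> space M \<Longrightarrow> sym_pos_def (B k \<omega>)"
    and B_bounded: "\<And>k. AE \<omega> in M. spectral_norm (B k \<omega>) \<le> Bmax"
    and \<beta>_pos: "0 < \<beta>"
    and \<alpha>_pos: "\<And>k. 0 < \<alpha> k"
    and \<alpha>_square_summable: "summable (\<lambda>k. (\<alpha> k)\<^sup>2)"
    and gram_invertible: "invertible (transpose A ** A)"
    and residual: "transpose A *v r = 0"
    and u0_measurable: "u 0 \<in> borel_measurable (F 0)"
    and u0_square_integrable: "integrable M (\<lambda>\<omega>. (norm (u 0 \<omega>))\<^sup>2)"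
    and u_Suc: "\<And>k \<omega>. \<omega> \<in> space M \<Longrightarrow> u (Suc k) \<omega>
      = u k \<omega> - \<alpha> k *\<^sub>R (B k \<omega> *v (transpose A *v (S k \<omega> *v (A *v u k \<omega> - r))))"
begin

definition res :: "nat \<Rightarrow> 'a \<Rightarrow> real ^ 'm" where
  "res k \<omega> = A *v u k \<omega> - r"

definition direction :: "nat \<Rightarrow> 'a \<Rightarrow> real ^ 'n" where
  "direction k \<omega> = B k \<omega> *v (transpose A *v (S k \<omega> *v res k \<omega>))"

definition err :: "nat \<Rightarrow> 'a \<Rightarrow> real" where
  "err k \<omega> = (norm (A *v u k \<omega>))\<^sup>2"

definition gradient :: "nat \<Rightarrow> 'a \<Rightarrow> real ^ 'n" where
  "gradient k \<omega> = transpose A *v (A *v u k \<omega>)"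

text \<open>The constant in \<open>expected_noise_le\<close>: the factors \<open>2\<close> and \<open>max 1 \<parallel>r\<parallel>\<^sup>2\<close> come from
  \<open>\<parallel>A u - r\<parallel>\<^sup>2 \<le> 2 \<parallel>A u\<parallel>\<^sup>2 + 2 \<parallel>r\<parallel>\<^sup>2 \<le> 2 max 1 \<parallel>r\<parallel>\<^sup>2 (\<parallel>A u\<parallel>\<^sup>2 + 1)\<close>, so that a single
  constant governs both the multiplicative and the additive part of the noise.\<close>

definition noise_const :: real where
  "noise_const = 2 * (spectral_norm A * (Bmax * spectral_norm (transpose A)))\<^sup>2 * \<mu>
    * max 1 ((norm r)\<^sup>2)"

lemma u_step: "\<omega> \<in> space M \<Longrightarrow> u (Suc k) \<omega> = u k \<omega> - \<alpha> k *\<^sub>R direction k \<omega>"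
  by (simp add: u_Suc direction_def res_def)

lemma u_adapted: "u k \<in> borel_measurable (F k)"
proof (induction k)
  case 0
  show ?case by (rule u0_measurable)
next
  case (Suc k)
  note [measurable] = measurable_later[OF Suc] measurable_later[OF B_measurable[of k]] S_measurable[of k]
  have "(\<lambda>\<omega>. u k \<omega> - \<alpha> k *\<^sub>R direction k \<omega>) \<in> borel_measurable (F (Suc k))"
    unfolding direction_def res_def by measurable
  then show ?case
    by (subst measurable_cong[of "F (Suc k)" _ "\<lambda>\<omega>. u k \<omega> - \<alpha> k *\<^sub>R direction k \<omega>"])
      (auto simp: space_F u_step)
qed

lemma res_adapted: "res k \<in> borel_measurable (F k)"
  and err_adapted: "err k \<in> borel_measurable (F k)"
  and gradient_adapted: "gradient k \<in> borel_measurable (F k)"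
  using u_adapted[of k] unfolding res_def[abs_def] err_def[abs_def] gradient_def[abs_def]
  by measurable

lemma measurables [measurable]:
  "u k \<in> borel_measurable M" "res k \<in> borel_measurable M" "err k \<in> borel_measurable M"
  "gradient k \<in> borel_measurable M" "B k \<in> borel_measurable M" "S k \<in> borel_measurable M"
  "direction k \<in> borel_measurable M"
proof -
  show [measurable]: "u k \<in> borel_measurable M" "res k \<in> borel_measurable M"
    "err k \<in> borel_measurable M" "gradient k \<in> borel_measurable M" "B k \<in> borel_measurable M"
    "S k \<in> borel_measurable M"
    by (rule adapted_measurable[OF u_adapted] adapted_measurable[OF res_adapted]
        adapted_measurable[OF err_adapted] adapted_measurable[OF gradient_adapted]
        adapted_measurable[OF B_measurable] adapted_measurable[OF S_measurable])+
  show "direction k \<in> borel_measurable M"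
    unfolding direction_def[abs_def] by measurable
qed

lemma \<mu>_nonneg: "0 \<le> \<mu>"
  using S_second_moment[of 0] by (auto simp: has_bochner_integral_iff)

lemma Bmax_nonneg: "0 \<le> Bmax"
proof -
  have "AE \<omega> in M. 0 \<le> Bmax"
    using B_bounded[of 0]
    by eventually_elim (use spectral_norm_nonneg in \<open>blast intro: order_trans\<close>)
  then show ?thesis by (simp add: AE_const)
qed

lemma noise_const_nonneg: "0 \<le> noise_const"
  unfolding noise_const_def by (intro mult_nonneg_nonneg) (auto simp: \<mu>_nonneg)

lemma res_norm_le: "(norm (res k \<omega>))\<^sup>2 \<le> 2 * err k \<omega> + 2 * (norm r)\<^sup>2"
  unfolding res_def err_def by (rule norm_diff_squared_le)

lemma err_le: "err k \<omega> \<le> (spectral_norm A)\<^sup>2 * (norm (u k \<omega>))\<^sup>2"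
  unfolding err_def power_mult_distrib[symmetric]
  by (intro power_mono norm_matrix_vector_mult_le_spectral_norm) simp

lemma direction_norm_le:
  "AE \<omega> in M. norm (direction k \<omega>)
    \<le> Bmax * spectral_norm (transpose A) * norm (S k \<omega>) * norm (res k \<omega>)"
  using B_bounded[of k]
proof eventually_elim
  case (elim \<omega>)
  have "norm (direction k \<omega>)
      \<le> spectral_norm (B k \<omega>) * (spectral_norm (transpose A) * (norm (S k \<omega>) * norm (res k \<omega>)))"
    unfolding direction_def
    by (intro order_trans[OF norm_matrix_vector_mult_le_spectral_norm] mult_left_mono
        norm_matrix_vector_mult_le spectral_norm_nonneg)
  also have "\<dots> \<le> Bmax * (spectral_norm (transpose A) * (norm (S k \<omega>) * norm (res k \<omega>)))"
    using elim by (intro mult_right_mono mult_nonneg_nonneg spectral_norm_nonneg) auto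
  finally show ?case by (simp add: ac_simps)
qed

lemma sketched_res_second_moment:
  assumes G: "G \<in> sets (F k)" and int: "integrable M (\<lambda>\<omega>. (norm (res k \<omega>))\<^sup>2)"
  shows "has_bochner_integral M
    (\<lambda>\<omega>. indicator G \<omega> * (norm (res k \<omega>))\<^sup>2 * (norm (S k \<omega>))\<^sup>2)
    ((\<integral>\<omega>. indicator G \<omega> * (norm (res k \<omega>))\<^sup>2 \<partial>M) * \<mu>)"
proof -
  have GM: "G \<in> sets M" using G by (rule sets_F_subset)
  have h: "(\<lambda>P :: real ^ 'm ^ 'm. (norm P)\<^sup>2) \<in> borel_measurable borel" by measurable
  have Y: "(\<lambda>\<omega>. indicator G \<omega> * (norm (res k \<omega>))\<^sup>2) \<in> borel_measurable (F k)"
    using res_adapted[of k] G by measurable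
  have Yi: "integrable M (\<lambda>\<omega>. indicator G \<omega> * (norm (res k \<omega>))\<^sup>2)"
    using integrable_real_mult_indicator[OF GM int] by (simp add: mult.commute)
  show ?thesis
    using integral_mult_indep[OF subalgebra S_indep _ h Y Yi] S_second_moment[of k]
    by (simp add: has_bochner_integral_iff)
qed

lemma square_integrable_res:
  assumes "integrable M (\<lambda>\<omega>. (norm (u k \<omega>))\<^sup>2)"
  shows "integrable M (err k)" "integrable M (\<lambda>\<omega>. (norm (res k \<omega>))\<^sup>2)"
proof -
  have "integrable M (\<lambda>\<omega>. (spectral_norm A)\<^sup>2 * (norm (u k \<omega>))\<^sup>2)"
    using assms by simp
  then show err: "integrable M (err k)"
    by (rule Bochner_Integration.integrable_bound) (use err_le in \<open>auto simp: err_def\<close>)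
  then have "integrable M (\<lambda>\<omega>. 2 * err k \<omega> + 2 * (norm r)\<^sup>2)" by simp
  then show "integrable M (\<lambda>\<omega>. (norm (res k \<omega>))\<^sup>2)"
    by (rule Bochner_Integration.integrable_bound) (auto intro!: AE_I2 order_trans[OF res_norm_le abs_ge_self])
qed

lemma square_integrable_direction:
  assumes "integrable M (\<lambda>\<omega>. (norm (u k \<omega>))\<^sup>2)"
  shows "integrable M (\<lambda>\<omega>. (norm (direction k \<omega>))\<^sup>2)"
proof -
  have "space M \<in> sets (F k)" using sets.top[of "F k"] by (simp add: space_F)
  from sketched_res_second_moment[OF this square_integrable_res(2)[OF assms]]
  have "integrable M (\<lambda>\<omega>. (Bmax * spectral_norm (transpose A))\<^sup>2 *
      (indicator (space M) \<omega> * (norm (res k \<omega>))\<^sup>2 * (norm (S k \<omega>))\<^sup>2))"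
    by (intro integrable_mult_right) (simp add: has_bochner_integral_iff)
  then show ?thesis
  proof (rule Bochner_Integration.integrable_bound)
    show "AE \<omega> in M. norm ((norm (direction k \<omega>))\<^sup>2) \<le> norm ((Bmax * spectral_norm (transpose A))\<^sup>2 *
      (indicator (space M) \<omega> * (norm (res k \<omega>))\<^sup>2 * (norm (S k \<omega>))\<^sup>2))"
      using direction_norm_le[of k] AE_space
    proof eventually_elim
      case (elim \<omega>)
      from power_mono[OF elim(1) norm_ge_zero, of 2] elim(2) show ?case
        by (simp add: power_mult_distrib ac_simps)
    qed
  qed measurable
qed

text \<open>The size of a step is bounded by a product of \<open>\<parallel>S\<^sub>k\<parallel>\<close> and the residual, whose squares are independent;
  finite second moments therefore propagate from one iterate to the next.\<close>

lemma square_integrable_u: "integrable M (\<lambda>\<omega>. (norm (u k \<omega>))\<^sup>2)"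
proof (induction k)
  case 0
  show ?case by (rule u0_square_integrable)
next
  case (Suc k)
  have "integrable M (\<lambda>\<omega>. 2 * (norm (u k \<omega>))\<^sup>2 + 2 * (\<alpha> k)\<^sup>2 * (norm (direction k \<omega>))\<^sup>2)"
    using Suc square_integrable_direction[OF Suc] by simp
  then show ?case
  proof (rule Bochner_Integration.integrable_bound)
    show "AE \<omega> in M. norm ((norm (u (Suc k) \<omega>))\<^sup>2)
        \<le> norm (2 * (norm (u k \<omega>))\<^sup>2 + 2 * (\<alpha> k)\<^sup>2 * (norm (direction k \<omega>))\<^sup>2)"
      using AE_space
    proof eventually_elim
      case (elim \<omega>)
      then show ?case
        using norm_diff_squared_le[of "u k \<omega>" "\<alpha> k *\<^sub>R direction k \<omega>"]
        by (simp add: u_step power_mult_distrib)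
    qed
  qed measurable
qed

lemmas integrable_err = square_integrable_res(1)[OF square_integrable_u]
lemmas integrable_res = square_integrable_res(2)[OF square_integrable_u]

lemma expected_noise_le:
  assumes G: "G \<in> sets (F k)"
  shows "integrable M (\<lambda>\<omega>. indicator G \<omega> * (norm (A *v direction k \<omega>))\<^sup>2)" (is ?int)
    and "(\<integral>\<omega>. indicator G \<omega> * (norm (A *v direction k \<omega>))\<^sup>2 \<partial>M)
      \<le> noise_const * ((\<integral>\<omega>. indicator G \<omega> * err k \<omega> \<partial>M) + prob G)" (is ?le)
proof -
  have GM: "G \<in> sets M" using G by (rule sets_F_subset)
  define c where "c = (spectral_norm A * (Bmax * spectral_norm (transpose A)))\<^sup>2"
  let ?R = "\<lambda>\<omega>. indicator G \<omega> * (norm (res k \<omega>))\<^sup>2 * (norm (S k \<omega>))\<^sup>2"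
  note R = sketched_res_second_moment[OF G integrable_res]
  have bound: "AE \<omega> in M. indicator G \<omega> * (norm (A *v direction k \<omega>))\<^sup>2 \<le> c * ?R \<omega>"
    using direction_norm_le[of k]
  proof eventually_elim
    case (elim \<omega>)
    have "norm (A *v direction k \<omega>) \<le> spectral_norm A *
        (Bmax * spectral_norm (transpose A) * norm (S k \<omega>) * norm (res k \<omega>))"
      using elim by (intro order_trans[OF norm_matrix_vector_mult_le_spectral_norm]
          mult_left_mono spectral_norm_nonneg)
    from power_mono[OF this norm_ge_zero, of 2] show ?case
      by (auto simp: c_def power_mult_distrib indicator_def ac_simps)
  qed
  have Ri: "integrable M (\<lambda>\<omega>. c * ?R \<omega>)" using R by (simp add: has_bochner_integral_iff)
  show ?int
    by (rule Bochner_Integration.integrable_bound[OF Ri])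
      (use bound GM in \<open>auto simp: abs_mult c_def elim!: eventually_mono\<close>)
  then have "(\<integral>\<omega>. indicator G \<omega> * (norm (A *v direction k \<omega>))\<^sup>2 \<partial>M) \<le> (\<integral>\<omega>. c * ?R \<omega> \<partial>M)"
    using Ri bound by (rule integral_mono_AE)
  also have "\<dots> = c * \<mu> * (\<integral>\<omega>. indicator G \<omega> * (norm (res k \<omega>))\<^sup>2 \<partial>M)"
    using R by (simp add: has_bochner_integral_iff)
  finally have noise: "(\<integral>\<omega>. indicator G \<omega> * (norm (A *v direction k \<omega>))\<^sup>2 \<partial>M)
      \<le> c * \<mu> * (\<integral>\<omega>. indicator G \<omega> * (norm (res k \<omega>))\<^sup>2 \<partial>M)" .
  have "(\<integral>\<omega>. indicator G \<omega> * (norm (res k \<omega>))\<^sup>2 \<partial>M)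
      \<le> (\<integral>\<omega>. 2 * max 1 ((norm r)\<^sup>2) * (indicator G \<omega> * err k \<omega> + indicator G \<omega>) \<partial>M)"
  proof (rule integral_mono)
    show "integrable M (\<lambda>\<omega>. indicator G \<omega> * (norm (res k \<omega>))\<^sup>2)"
      using integrable_real_mult_indicator[OF GM integrable_res] by (simp add: mult.commute)
    show "integrable M (\<lambda>\<omega>. 2 * max 1 ((norm r)\<^sup>2) * (indicator G \<omega> * err k \<omega> + indicator G \<omega>))"
      using integrable_real_mult_indicator[OF GM integrable_err[of k]] GM
      by (intro integrable_mult_right Bochner_Integration.integrable_add integrable_real_indicator)
        (auto simp: mult.commute less_top[symmetric])
    fix \<omega>
    have "err k \<omega> \<le> max 1 ((norm r)\<^sup>2) * err k \<omega>"
      using mult_right_mono[of 1 "max 1 ((norm r)\<^sup>2)" "err k \<omega>"] by (simp add: err_def)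
    then have "(norm (res k \<omega>))\<^sup>2 \<le> 2 * max 1 ((norm r)\<^sup>2) * (err k \<omega> + 1)"
      using res_norm_le[of k \<omega>] by (simp add: algebra_simps)
    then show "indicator G \<omega> * (norm (res k \<omega>))\<^sup>2
        \<le> 2 * max 1 ((norm r)\<^sup>2) * (indicator G \<omega> * err k \<omega> + indicator G \<omega>)"
      by (auto simp: indicator_def)
  qed
  also have "\<dots> = 2 * max 1 ((norm r)\<^sup>2) * ((\<integral>\<omega>. indicator G \<omega> * err k \<omega> \<partial>M) + prob G)"
    using integrable_real_mult_indicator[OF GM integrable_err[of k]] GM
    by (subst Bochner_Integration.integral_mult_right_zero, subst Bochner_Integration.integral_add)
      (auto simp: mult.commute less_top[symmetric] Int_absorb2[OF sets.sets_into_space])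
  finally have "c * \<mu> * (\<integral>\<omega>. indicator G \<omega> * (norm (res k \<omega>))\<^sup>2 \<partial>M)
      \<le> c * \<mu> * (2 * max 1 ((norm r)\<^sup>2) * ((\<integral>\<omega>. indicator G \<omega> * err k \<omega> \<partial>M) + prob G))"
    using \<mu>_nonneg by (intro mult_left_mono) (auto simp: c_def)
  also have "\<dots> = noise_const * ((\<integral>\<omega>. indicator G \<omega> * err k \<omega> \<partial>M) + prob G)"
    by (simp add: noise_const_def c_def)
  finally show ?le using noise by linarith
qed

lemma gradient_norm_le:
  "norm (gradient k \<omega>) \<le> spectral_norm (transpose A) * norm (A *v u k \<omega>)"
  unfolding gradient_def by (rule norm_matrix_vector_mult_le_spectral_norm)

lemma preconditioned_gradient_norm_le:
  "AE \<omega> in M. norm (B k \<omega> *v gradient k \<omega>)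
    \<le> Bmax * (spectral_norm (transpose A) * norm (A *v u k \<omega>))"
  using B_bounded[of k]
proof eventually_elim
  case (elim \<omega>)
  show ?case
    by (rule order_trans[OF norm_matrix_vector_mult_le_spectral_norm])
      (intro mult_mono elim gradient_norm_le Bmax_nonneg norm_ge_zero)
qed

lemma integrable_descent: "integrable M (\<lambda>\<omega>. gradient k \<omega> \<bullet> (B k \<omega> *v gradient k \<omega>))"
proof -
  define a where "a = spectral_norm (transpose A)"
  have a: "0 \<le> a" by (simp add: a_def spectral_norm_nonneg)
  have "integrable M (\<lambda>\<omega>. Bmax * a\<^sup>2 * err k \<omega>)" using integrable_err by simp
  then show "integrable M (\<lambda>\<omega>. gradient k \<omega> \<bullet> (B k \<omega> *v gradient k \<omega>))"
  proof (rule Bochner_Integration.integrable_bound)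
    show "AE \<omega> in M. norm (gradient k \<omega> \<bullet> (B k \<omega> *v gradient k \<omega>)) \<le> norm (Bmax * a\<^sup>2 * err k \<omega>)"
      using preconditioned_gradient_norm_le[of k, folded a_def]
    proof eventually_elim
      case (elim \<omega>)
      have "norm (gradient k \<omega> \<bullet> (B k \<omega> *v gradient k \<omega>))
          \<le> norm (gradient k \<omega>) * norm (B k \<omega> *v gradient k \<omega>)"
        by (simp add: Cauchy_Schwarz_ineq2)
      also have "\<dots> \<le> (a * norm (A *v u k \<omega>)) * (Bmax * (a * norm (A *v u k \<omega>)))"
        using a by (intro mult_mono elim gradient_norm_le[folded a_def]) auto
      also have "\<dots> = Bmax * a\<^sup>2 * err k \<omega>"
        by (simp add: err_def power2_eq_square)
      finally show ?case by (rule order_trans) (simp only: real_norm_def abs_ge_self)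
    qed
  qed measurable
qed

text \<open>Moving \<open>A\<close>, \<open>B\<close> and \<open>A\<^sup>T\<close> to the left factor leaves a bilinear form \<open>p \<bullet> S (A u - r)\<close> in which \<open>S\<close>
  can be averaged to \<open>\<beta> I\<close>. The residual then drops out because \<open>A\<^sup>T r = 0\<close>, and what remains is the
  quadratic form of \<open>B\<close> at the gradient.\<close>

lemma expected_descent:
  assumes G: "G \<in> sets (F k)"
  shows "has_bochner_integral M
    (\<lambda>\<omega>. indicator G \<omega> * ((A *v u k \<omega>) \<bullet> (A *v direction k \<omega>)))
    (\<beta> * (\<integral>\<omega>. indicator G \<omega> * (gradient k \<omega> \<bullet> (B k \<omega> *v gradient k \<omega>)) \<partial>M))"
proof -
  have GM: "G \<in> sets M" using G by (rule sets_F_subset)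
  define p where "p \<omega> = indicator G \<omega> *\<^sub>R (A *v (B k \<omega> *v gradient k \<omega>))" for \<omega>
  have sym: "transpose (B k \<omega>) = B k \<omega>" if "\<omega> \<in> space M" for \<omega>
    using B_spd[OF that] by (simp add: sym_pos_def_def)
  define a where "a = spectral_norm (transpose A)"
  have a: "0 \<le> a" by (simp add: a_def spectral_norm_nonneg)
  have p: "p \<in> borel_measurable (F k)"
    using gradient_adapted[of k] B_measurable[of k] G unfolding p_def[abs_def] by measurable
  have p_le: "AE \<omega> in M. norm (p \<omega>) \<le> spectral_norm A * (Bmax * a) * norm (A *v u k \<omega>)"
    using preconditioned_gradient_norm_le[of k, folded a_def]
  proof eventually_elim
    case (elim \<omega>)
    have "norm (p \<omega>) \<le> norm (A *v (B k \<omega> *v gradient k \<omega>))"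
      by (auto simp: p_def indicator_def)
    also have "\<dots> \<le> spectral_norm A * (Bmax * (a * norm (A *v u k \<omega>)))"
      by (rule order_trans[OF norm_matrix_vector_mult_le_spectral_norm])
        (intro mult_left_mono elim spectral_norm_nonneg)
    finally show ?case by (simp only: mult.assoc)
  qed
  have bound_int: "integrable M (\<lambda>\<omega>. spectral_norm A * (Bmax * a) * (err k \<omega> + (norm (res k \<omega>))\<^sup>2))"
    using integrable_err[of k] integrable_res[of k] by simp
  have int: "integrable M (\<lambda>\<omega>. p \<omega> $ i * res k \<omega> $ j)" for i j
  proof (rule Bochner_Integration.integrable_bound[OF bound_int])
    have [measurable]: "p \<in> borel_measurable M" using p by (rule adapted_measurable)
    show "(\<lambda>\<omega>. p \<omega> $ i * res k \<omega> $ j) \<in> borel_measurable M" by measurable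
    show "AE \<omega> in M. norm (p \<omega> $ i * res k \<omega> $ j)
        \<le> norm (spectral_norm A * (Bmax * a) * (err k \<omega> + (norm (res k \<omega>))\<^sup>2))"
      using p_le
    proof eventually_elim
      case (elim \<omega>)
      have "norm (p \<omega> $ i * res k \<omega> $ j) \<le> norm (p \<omega>) * norm (res k \<omega>)"
        unfolding norm_mult by (intro mult_mono) (auto intro: component_le_norm_cart)
      also have "\<dots> \<le> spectral_norm A * (Bmax * a) * norm (A *v u k \<omega>) * norm (res k \<omega>)"
        using elim by (intro mult_right_mono) auto
      also have "\<dots> = spectral_norm A * (Bmax * a) * (norm (A *v u k \<omega>) * norm (res k \<omega>))"
        by simp
      also have "\<dots> \<le> spectral_norm A * (Bmax * a) * (err k \<omega> + (norm (res k \<omega>))\<^sup>2)"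
      proof (intro mult_left_mono mult_nonneg_nonneg spectral_norm_nonneg Bmax_nonneg a)
        have "norm (A *v u k \<omega>) * norm (res k \<omega>) * 2 \<le> err k \<omega> + (norm (res k \<omega>))\<^sup>2"
          using sum_squares_bound[of "norm (A *v u k \<omega>)" "norm (res k \<omega>)"] by (simp add: err_def)
        moreover have "0 \<le> norm (A *v u k \<omega>) * norm (res k \<omega>)" by simp
        ultimately show "norm (A *v u k \<omega>) * norm (res k \<omega>) \<le> err k \<omega> + (norm (res k \<omega>))\<^sup>2"
          by linarith
      qed
      finally show ?case by (rule order_trans) (simp only: real_norm_def abs_ge_self)
    qed
  qed
  note main = integral_bilinear_indep[OF subalgebra S_indep S_mean p res_adapted int]
  have "has_bochner_integral M (\<lambda>\<omega>. indicator G \<omega> * ((A *v u k \<omega>) \<bullet> (A *v direction k \<omega>)))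
      (\<integral>\<omega>. p \<omega> \<bullet> ((\<beta> *\<^sub>R mat 1) *v res k \<omega>) \<partial>M)"
  proof (subst has_bochner_integral_cong[OF refl _ refl, THEN iffD2, OF _ main])
    fix \<omega> assume "\<omega> \<in> space M"
    then show "indicator G \<omega> * ((A *v u k \<omega>) \<bullet> (A *v direction k \<omega>)) = p \<omega> \<bullet> (S k \<omega> *v res k \<omega>)"
      by (simp add: p_def direction_def gradient_def inner_matrix_vector_adjoint
          matrix_vector_mult_scaleR sym)
  qed simp
  moreover have "(\<integral>\<omega>. p \<omega> \<bullet> ((\<beta> *\<^sub>R mat 1) *v res k \<omega>) \<partial>M)
      = (\<integral>\<omega>. \<beta> * (indicator G \<omega> * (gradient k \<omega> \<bullet> (B k \<omega> *v gradient k \<omega>))) \<partial>M)"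
  proof (intro Bochner_Integration.integral_cong refl)
    fix \<omega>
    have "(A *v (B k \<omega> *v gradient k \<omega>)) \<bullet> res k \<omega> = (B k \<omega> *v gradient k \<omega>) \<bullet> (transpose A *v res k \<omega>)"
      by (simp add: inner_matrix_vector_adjoint)
    also have "transpose A *v res k \<omega> = gradient k \<omega>"
      by (simp add: res_def gradient_def matrix_vector_mult_diff_distrib residual)
    finally show "p \<omega> \<bullet> ((\<beta> *\<^sub>R mat 1) *v res k \<omega>)
        = \<beta> * (indicator G \<omega> * (gradient k \<omega> \<bullet> (B k \<omega> *v gradient k \<omega>)))"
      by (simp add: p_def scaleR_matrix_vector_assoc[symmetric] inner_commute)
  qed
  ultimately show "has_bochner_integral M
    (\<lambda>\<omega>. indicator G \<omega> * ((A *v u k \<omega>) \<bullet> (A *v direction k \<omega>)))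
    (\<beta> * (\<integral>\<omega>. indicator G \<omega> * (gradient k \<omega> \<bullet> (B k \<omega> *v gradient k \<omega>)) \<partial>M))"
    by simp
qed

lemma expected_err_step:
  assumes G: "G \<in> sets (F k)"
  shows "(\<integral>\<omega>. indicator G \<omega> * err (Suc k) \<omega> \<partial>M) \<le> (\<integral>\<omega>. indicator G \<omega> * err k \<omega> \<partial>M)
    - 2 * \<alpha> k * \<beta> * (\<integral>\<omega>. indicator G \<omega> * (gradient k \<omega> \<bullet> (B k \<omega> *v gradient k \<omega>)) \<partial>M)
    + (\<alpha> k)\<^sup>2 * noise_const * ((\<integral>\<omega>. indicator G \<omega> * err k \<omega> \<partial>M) + prob G)"
proof -
  have GM: "G \<in> sets M" using G by (rule sets_F_subset)
  let ?e = "\<lambda>\<omega>. indicator G \<omega> * err k \<omega>"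
  let ?c = "\<lambda>\<omega>. indicator G \<omega> * ((A *v u k \<omega>) \<bullet> (A *v direction k \<omega>))"
  let ?n = "\<lambda>\<omega>. indicator G \<omega> * (norm (A *v direction k \<omega>))\<^sup>2"
  have int: "integrable M ?e" "integrable M ?c" "integrable M ?n"
    using integrable_real_mult_indicator[OF GM integrable_err[of k]] expected_descent[OF G]
      expected_noise_le(1)[OF G]
    by (auto simp: mult.commute has_bochner_integral_iff)
  have "(\<integral>\<omega>. indicator G \<omega> * err (Suc k) \<omega> \<partial>M)
      = (\<integral>\<omega>. ?e \<omega> - 2 * \<alpha> k * ?c \<omega> + (\<alpha> k)\<^sup>2 * ?n \<omega> \<partial>M)"
  proof (intro Bochner_Integration.integral_cong refl)
    fix \<omega> assume "\<omega> \<in> space M"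
    then have eq: "A *v u (Suc k) \<omega> = A *v u k \<omega> - \<alpha> k *\<^sub>R (A *v direction k \<omega>)"
      by (simp add: u_step matrix_vector_mult_diff_distrib matrix_vector_mult_scaleR)
    have expand: "err (Suc k) \<omega> = err k \<omega> - 2 * \<alpha> k * ((A *v u k \<omega>) \<bullet> (A *v direction k \<omega>))
        + (\<alpha> k)\<^sup>2 * (norm (A *v direction k \<omega>))\<^sup>2"
      unfolding err_def eq power2_norm_eq_inner
      by (simp add: inner_diff_left inner_diff_right inner_commute power2_eq_square algebra_simps)
    show "indicator G \<omega> * err (Suc k) \<omega> = ?e \<omega> - 2 * \<alpha> k * ?c \<omega> + (\<alpha> k)\<^sup>2 * ?n \<omega>"
      unfolding expand by (simp add: algebra_simps)
  qed
  also have "\<dots> = (\<integral>\<omega>. ?e \<omega> \<partial>M) - 2 * \<alpha> k * (\<integral>\<omega>. ?c \<omega> \<partial>M) + (\<alpha> k)\<^sup>2 * (\<integral>\<omega>. ?n \<omega> \<partial>M)"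
    using int by simp
  also have "(\<integral>\<omega>. ?c \<omega> \<partial>M)
      = \<beta> * (\<integral>\<omega>. indicator G \<omega> * (gradient k \<omega> \<bullet> (B k \<omega> *v gradient k \<omega>)) \<partial>M)"
    using expected_descent[OF G] by (rule has_bochner_integral_integral_eq)
  finally show ?thesis
    using mult_left_mono[OF expected_noise_le(2)[OF G], of "(\<alpha> k)\<^sup>2"] by (simp add: mult.assoc)
qed

text \<open>The remainder \<open>q\<^sub>k\<close> of \<open>\<Sum> \<alpha>\<^sup>2\<close> from index \<open>k\<close> on. In \<open>lyapunov\<close> the summand \<open>K q\<^sub>k\<close> pays in advance for the
  additive noise of all future steps and the factor \<open>exp (K q\<^sub>k)\<close> for the multiplicative noise.\<close>

definition step_tail :: "nat \<Rightarrow> real" where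
  "step_tail k = (\<Sum>n. (\<alpha> n)\<^sup>2) - (\<Sum>i<k. (\<alpha> i)\<^sup>2)"

definition lyapunov :: "nat \<Rightarrow> 'a \<Rightarrow> real" where
  "lyapunov k \<omega> = exp (noise_const * step_tail k) * (err k \<omega> + noise_const * step_tail k)"

definition decrement :: "nat \<Rightarrow> 'a \<Rightarrow> real" where
  "decrement k \<omega> = 2 * \<alpha> k * \<beta> * (gradient k \<omega> \<bullet> (B k \<omega> *v gradient k \<omega>))"

lemma step_tail_Suc: "step_tail k = (\<alpha> k)\<^sup>2 + step_tail (Suc k)"
  by (simp add: step_tail_def)

lemma step_tail_nonneg: "0 \<le> step_tail k"
  unfolding step_tail_def using sum_le_suminf[OF \<alpha>_square_summable, of "{..<k}"] by simp

lemma step_tail_tendsto_zero: "step_tail \<longlonglongrightarrow> 0"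
proof -
  have "(\<lambda>k. (\<Sum>n. (\<alpha> n)\<^sup>2) - (\<Sum>i<k. (\<alpha> i)\<^sup>2)) \<longlonglongrightarrow> (\<Sum>n. (\<alpha> n)\<^sup>2) - (\<Sum>n. (\<alpha> n)\<^sup>2)"
    by (intro tendsto_diff tendsto_const summable_LIMSEQ \<alpha>_square_summable)
  then show ?thesis by (simp add: step_tail_def[abs_def])
qed

lemma decrement_ge:
  assumes "\<omega> \<in> space M"
  shows "2 * \<beta> * (\<alpha> k * lambda_min (B k \<omega>)) * (norm (gradient k \<omega>))\<^sup>2 \<le> decrement k \<omega>"
proof -
  have "transpose (B k \<omega>) = B k \<omega>" using B_spd[OF assms] by (simp add: sym_pos_def_def)
  from mult_left_mono[OF lambda_min_le_rayleigh[OF this, of "gradient k \<omega>"], of "2 * \<beta> * \<alpha> k"]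
  show ?thesis
    unfolding decrement_def using \<beta>_pos \<alpha>_pos[of k] by (simp add: ac_simps)
qed

lemma decrement_nonneg:
  assumes "\<omega> \<in> space M"
  shows "0 \<le> decrement k \<omega>"
proof -
  have "0 < lambda_min (B k \<omega>)" using B_spd[OF assms] by (rule lambda_min_pos)
  then have "0 \<le> 2 * \<beta> * (\<alpha> k * lambda_min (B k \<omega>)) * (norm (gradient k \<omega>))\<^sup>2"
    using \<beta>_pos \<alpha>_pos[of k] by simp
  then show ?thesis using decrement_ge[OF assms, of k] by linarith
qed

text \<open>With \<open>q\<^sub>k = \<alpha>\<^sup>2 + q\<^sub>k\<^sub>+\<^sub>1\<close>, the additive noise \<open>K \<alpha>\<^sup>2\<close> and the reserve \<open>K q\<^sub>k\<^sub>+\<^sub>1\<close> combine to \<open>K q\<^sub>k\<close>, and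
  \<open>1 + K \<alpha>\<^sup>2 \<le> exp (K \<alpha>\<^sup>2)\<close> turns \<open>exp (K q\<^sub>k\<^sub>+\<^sub>1)\<close> into \<open>exp (K q\<^sub>k)\<close>. The loss survives undiminished
  since the exponential factor in front of it is at least \<open>1\<close>.\<close>

lemma lyapunov_dissipation:
  assumes G: "G \<in> sets (F k)"
  shows "(\<integral>\<omega>. indicator G \<omega> * lyapunov (Suc k) \<omega> \<partial>M) + (\<integral>\<omega>. indicator G \<omega> * decrement k \<omega> \<partial>M)
    \<le> (\<integral>\<omega>. indicator G \<omega> * lyapunov k \<omega> \<partial>M)"
proof -
  have GM: "G \<in> sets M" using G by (rule sets_F_subset)
  define K where "K = noise_const"
  define E where "E j = (\<integral>\<omega>. indicator G \<omega> * err j \<omega> \<partial>M)" for j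
  define d where "d = (\<integral>\<omega>. indicator G \<omega> * decrement k \<omega> \<partial>M)"
  have K: "0 \<le> K" unfolding K_def by (rule noise_const_nonneg)
  have E: "0 \<le> E j" for j unfolding E_def by (auto simp: err_def)
  have d: "0 \<le> d"
    unfolding d_def by (intro integral_nonneg_AE AE_I2) (simp add: decrement_nonneg)
  have lyapunov: "(\<integral>\<omega>. indicator G \<omega> * lyapunov j \<omega> \<partial>M)
      = exp (K * step_tail j) * (E j + K * step_tail j * prob G)" for j
  proof -
    have ints: "integrable M (\<lambda>\<omega>. indicator G \<omega> * err j \<omega>)" "integrable M (indicator G :: _ \<Rightarrow> real)"
      using integrable_real_mult_indicator[OF GM integrable_err[of j]] GM
      by (auto simp: mult.commute less_top[symmetric])
    have "(\<integral>\<omega>. indicator G \<omega> * lyapunov j \<omega> \<partial>M)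
      = (\<integral>\<omega>. exp (K * step_tail j) * (indicator G \<omega> * err j \<omega> + K * step_tail j * indicator G \<omega>) \<partial>M)"
      by (simp add: lyapunov_def K_def algebra_simps)
    also have "\<dots> = exp (K * step_tail j) * (E j + K * step_tail j * (\<integral>\<omega>. indicator G \<omega> \<partial>M))"
      unfolding E_def using ints by simp
    also have "(\<integral>\<omega>. indicator G \<omega> \<partial>M) = prob G"
      using GM by (simp add: Int_absorb2[OF sets.sets_into_space])
    finally show ?thesis .
  qed
  have "d = 2 * \<alpha> k * \<beta> * (\<integral>\<omega>. indicator G \<omega> * (gradient k \<omega> \<bullet> (B k \<omega> *v gradient k \<omega>)) \<partial>M)"
    unfolding d_def decrement_def Bochner_Integration.integral_mult_right_zero[symmetric]
    by (intro Bochner_Integration.integral_cong refl) simp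
  then have step: "E (Suc k) + d \<le> E k + (\<alpha> k)\<^sup>2 * K * (E k + prob G)"
    using expected_err_step[OF G] by (simp add: E_def K_def)
  have "exp (K * step_tail (Suc k)) * (E (Suc k) + K * step_tail (Suc k) * prob G) + d
      \<le> exp (K * step_tail (Suc k)) * (E (Suc k) + d + K * step_tail (Suc k) * prob G)"
  proof -
    have "1 * d \<le> exp (K * step_tail (Suc k)) * d"
      using K d step_tail_nonneg by (intro mult_right_mono) auto
    then show ?thesis by (simp add: algebra_simps)
  qed
  also have "\<dots> \<le> exp (K * step_tail (Suc k)) * ((1 + K * (\<alpha> k)\<^sup>2) * E k + K * step_tail k * prob G)"
  proof (rule mult_left_mono)
    show "E (Suc k) + d + K * step_tail (Suc k) * prob G \<le> (1 + K * (\<alpha> k)\<^sup>2) * E k + K * step_tail k * prob G"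
      using step unfolding step_tail_Suc[of k] by (simp add: algebra_simps)
  qed simp
  also have "\<dots> \<le> exp (K * step_tail (Suc k)) * (exp (K * (\<alpha> k)\<^sup>2) * (E k + K * step_tail k * prob G))"
  proof (intro mult_left_mono)
    have "(1 + K * (\<alpha> k)\<^sup>2) * E k \<le> exp (K * (\<alpha> k)\<^sup>2) * E k"
      using E by (intro mult_right_mono exp_ge_add_one_self)
    moreover have "1 * (K * step_tail k * prob G) \<le> exp (K * (\<alpha> k)\<^sup>2) * (K * step_tail k * prob G)"
      using K step_tail_nonneg by (intro mult_right_mono) auto
    ultimately show "(1 + K * (\<alpha> k)\<^sup>2) * E k + K * step_tail k * prob G
        \<le> exp (K * (\<alpha> k)\<^sup>2) * (E k + K * step_tail k * prob G)"
      by (simp add: distrib_left)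
  qed simp
  also have "\<dots> = exp (K * step_tail k) * (E k + K * step_tail k * prob G)"
    unfolding step_tail_Suc[of k] distrib_left[of K] exp_add by (simp only: ac_simps)
  finally show ?thesis unfolding lyapunov d_def .
qed

sublocale dissipative_process M F lyapunov decrement
proof
  show "lyapunov k \<in> borel_measurable (F k)" for k
    using err_adapted[of k] unfolding lyapunov_def[abs_def] by measurable
  show "integrable M (lyapunov k)" for k
    unfolding lyapunov_def[abs_def] using integrable_err[of k] by simp
  show "integrable M (decrement k)" for k
    unfolding decrement_def[abs_def] using integrable_descent[of k] by simp
  show "0 \<le> lyapunov k \<omega>" for k \<omega>
    unfolding lyapunov_def using noise_const_nonneg step_tail_nonneg[of k] by (simp add: err_def)
qed (fact decrement_nonneg lyapunov_dissipation)+

text \<open>Full column rank makes \<open>A u\<close> a linear image of the gradient: \<open>A u = A (A\<^sup>T A)\<^sup>-\<^sup>1 g\<close>.\<close>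

lemma err_le_gradient: "\<exists>c>0. \<forall>k \<omega>. c * err k \<omega> \<le> (norm (gradient k \<omega>))\<^sup>2"
proof -
  define Q where "Q = A ** matrix_inv (transpose A ** A)"
  define c where "c = 1 + (spectral_norm Q)\<^sup>2"
  have "0 < c" unfolding c_def by (intro add_pos_nonneg) auto
  have "err k \<omega> \<le> c * (norm (gradient k \<omega>))\<^sup>2" for k \<omega>
  proof -
    have "Q *v gradient k \<omega> = A *v ((matrix_inv (transpose A ** A) ** (transpose A ** A)) *v u k \<omega>)"
      by (simp add: Q_def gradient_def matrix_vector_mul_assoc matrix_mul_assoc)
    then have "Q *v gradient k \<omega> = A *v u k \<omega>"
      by (simp add: matrix_inv_mult(2)[OF gram_invertible])
    then have "norm (A *v u k \<omega>) \<le> spectral_norm Q * norm (gradient k \<omega>)"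
      using norm_matrix_vector_mult_le_spectral_norm[of Q "gradient k \<omega>"] by simp
    from power_mono[OF this norm_ge_zero, of 2]
    have "err k \<omega> \<le> (spectral_norm Q)\<^sup>2 * (norm (gradient k \<omega>))\<^sup>2"
      by (simp add: err_def power_mult_distrib)
    also have "\<dots> \<le> c * (norm (gradient k \<omega>))\<^sup>2"
      unfolding c_def by (intro mult_right_mono) auto
    finally show ?thesis .
  qed
  then have "1 / c * err k \<omega> \<le> (norm (gradient k \<omega>))\<^sup>2" for k \<omega>
    using \<open>0 < c\<close> by (simp add: field_simps)
  then show ?thesis using \<open>0 < c\<close> by (intro exI[of _ "1 / c"]) auto
qed

text \<open>Were \<open>err\<close> eventually at least \<open>\<epsilon>\<close>, the losses would eventually dominate a fixed multiple of
  \<open>\<alpha> \<lambda>\<^sub>m\<^sub>i\<^sub>n(B)\<close>, whose sum diverges.\<close>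

lemma err_small_infinitely_often:
  assumes \<omega>: "\<omega> \<in> space M"
    and div: "filterlim (\<lambda>N. \<Sum>k<N. \<alpha> k * lambda_min (B k \<omega>)) at_top sequentially"
    and sum: "summable (\<lambda>k. decrement k \<omega>)" and "0 < \<epsilon>"
  shows "\<exists>k\<ge>n. err k \<omega> < \<epsilon>"
proof (rule ccontr)
  assume "\<not> ?thesis"
  then have large: "\<epsilon> \<le> err k \<omega>" if "n \<le> k" for k using that by (meson not_less)
  obtain c where c: "0 < c" "\<And>k. c * err k \<omega> \<le> (norm (gradient k \<omega>))\<^sup>2"
    using err_le_gradient by blast
  define w where "w k = \<alpha> k * lambda_min (B k \<omega>)" for k
  have w: "0 \<le> w k" for k
    unfolding w_def using \<alpha>_pos[of k] lambda_min_pos[OF B_spd[OF \<omega>, of k]] by simp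
  define a where "a = 2 * \<beta> * (c * \<epsilon>)"
  have a: "0 < a" unfolding a_def using \<beta>_pos c \<open>0 < \<epsilon>\<close> by simp
  have term_le: "a * w k \<le> decrement k \<omega>" if "n \<le> k" for k
  proof -
    have "c * \<epsilon> \<le> (norm (gradient k \<omega>))\<^sup>2"
      using mult_left_mono[OF large[OF that], of c] c by (meson less_imp_le order_trans)
    then have "2 * \<beta> * w k * (c * \<epsilon>) \<le> 2 * \<beta> * w k * (norm (gradient k \<omega>))\<^sup>2"
      using \<beta>_pos w by (intro mult_left_mono) auto
    also have "\<dots> \<le> decrement k \<omega>" using decrement_ge[OF \<omega>, of k] by (simp add: w_def)
    finally show ?thesis by (simp add: a_def ac_simps)
  qed
  have "summable (\<lambda>k. a * w k)"
    by (rule summable_comparison_test'[OF sum, of n]) (use term_le a w in auto)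
  then have "summable w" using a by (simp add: summable_cmult_iff)
  then have "(\<lambda>N. \<Sum>k<N. w k) \<longlonglongrightarrow> suminf w" by (rule summable_LIMSEQ)
  then show False
    using div not_tendsto_and_filterlim_at_infinity[of sequentially "\<lambda>N. \<Sum>k<N. w k"]
      filterlim_at_top_imp_at_infinity
    by (auto simp: w_def)
qed

lemma lyapunov_small:
  assumes "\<And>\<epsilon> n. 0 < \<epsilon> \<Longrightarrow> \<exists>k\<ge>n. err k \<omega> < \<epsilon>" and "0 < \<epsilon>"
  shows "\<exists>k. lyapunov k \<omega> < \<epsilon>"
proof -
  have "(\<lambda>k. noise_const * step_tail k) \<longlonglongrightarrow> noise_const * 0"
    by (intro tendsto_mult_left step_tail_tendsto_zero)
  then have lim: "(\<lambda>k. noise_const * step_tail k) \<longlonglongrightarrow> 0" by simp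
  then have "(\<lambda>k. exp (noise_const * step_tail k)) \<longlonglongrightarrow> exp 0" by (rule tendsto_exp)
  then have "eventually (\<lambda>k. exp (noise_const * step_tail k) < 2) sequentially"
    by (rule order_tendstoD) simp
  moreover have "eventually (\<lambda>k. noise_const * step_tail k < \<epsilon> / 4) sequentially"
    using lim by (rule order_tendstoD) (use \<open>0 < \<epsilon>\<close> in simp)
  ultimately obtain n where n: "\<And>k. n \<le> k \<Longrightarrow> exp (noise_const * step_tail k) < 2"
      "\<And>k. n \<le> k \<Longrightarrow> noise_const * step_tail k < \<epsilon> / 4"
    by (metis (mono_tags, lifting) eventually_conj eventually_sequentially)
  obtain k where k: "n \<le> k" "err k \<omega> < \<epsilon> / 4" using assms(1)[of "\<epsilon> / 4" n] \<open>0 < \<epsilon>\<close> by auto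
  have "lyapunov k \<omega> \<le> 2 * (err k \<omega> + noise_const * step_tail k)"
    unfolding lyapunov_def using n(1)[OF k(1)] noise_const_nonneg step_tail_nonneg
    by (intro mult_right_mono) (auto simp: err_def)
  also have "\<dots> < \<epsilon>" using k(2) n(2)[OF k(1)] by simp
  finally show ?thesis by blast
qed

text \<open>Since \<open>0 \<le> err \<le> lyapunov\<close>, the convergence of \<open>lyapunov\<close> gives \<open>A u\<^sub>k \<longlongrightarrow> 0\<close>, and \<open>u\<^sub>k\<close> is
  recovered from \<open>A u\<^sub>k\<close> through the left inverse \<open>(A\<^sup>T A)\<^sup>-\<^sup>1 A\<^sup>T\<close>.\<close>

theorem AE_error_tendsto_zero:
  assumes "AE \<omega> in M. filterlim (\<lambda>N. \<Sum>k<N. \<alpha> k * lambda_min (B k \<omega>)) at_top sequentially"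
  shows "AE \<omega> in M. (\<lambda>k. u k \<omega>) \<longlonglongrightarrow> 0"
proof -
  have "AE \<omega> in M. summable (\<lambda>k. decrement k \<omega>) \<longrightarrow> (\<forall>\<epsilon>>0. \<exists>k. lyapunov k \<omega> < \<epsilon>)"
    using assms AE_space
    by eventually_elim (blast intro: lyapunov_small err_small_infinitely_often)
  then have "AE \<omega> in M. (\<lambda>k. lyapunov k \<omega>) \<longlonglongrightarrow> 0" by (rule AE_tendsto_zero)
  then show ?thesis
  proof eventually_elim
    case (elim \<omega>)
    have "err k \<omega> \<le> lyapunov k \<omega>" for k
    proof -
      have K: "0 \<le> noise_const * step_tail k" using noise_const_nonneg step_tail_nonneg by simp
      have "err k \<omega> + 0 \<le> 1 * (err k \<omega> + noise_const * step_tail k)"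
        unfolding mult_1 by (intro add_left_mono K)
      also have "\<dots> \<le> lyapunov k \<omega>"
        unfolding lyapunov_def using K
        by (intro mult_right_mono add_nonneg_nonneg) (auto simp: err_def)
      finally show ?thesis by simp
    qed
    then have "(\<lambda>k. err k \<omega>) \<longlonglongrightarrow> 0"
      by (intro tendsto_sandwich[OF _ _ tendsto_const elim]) (auto simp: err_def)
    then have "(\<lambda>k. sqrt (err k \<omega>)) \<longlonglongrightarrow> sqrt 0" by (rule tendsto_real_sqrt)
    then have "(\<lambda>k. A *v u k \<omega>) \<longlonglongrightarrow> 0" by (simp add: err_def tendsto_norm_zero_iff)
    then have "(\<lambda>k. (matrix_inv (transpose A ** A) ** transpose A) *v (A *v u k \<omega>)) \<longlonglongrightarrow>
        (matrix_inv (transpose A ** A) ** transpose A) *v 0"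
      by (rule bounded_bilinear.tendsto[OF bounded_bilinear_matrix_vector_mult tendsto_const])
    then show ?case
      using matrix_inv_mult(2)[OF gram_invertible]
      by (simp add: matrix_vector_mul_assoc matrix_mul_assoc[symmetric])
  qed
qed

end

section \<open>Sketches generated by an i.i.d. sequence\<close>

lemma space_past_sigma: "space (past_sigma M W k) = space M"
  unfolding past_sigma_def by (rule space_measure_of) auto

lemma sets_past_sigma:
  "sets (past_sigma M W k) = sigma_sets (space M)
    (\<Union>i\<in>{1..<k}. {W i -` S \<inter> space M | S. S \<in> sets borel})"
proof -
  have "{W i -` S \<inter> space M | i S. 1 \<le> i \<and> i < k \<and> S \<in> sets borel}
      = (\<Union>i\<in>{1..<k}. {W i -` S \<inter> space M | S. S \<in> sets borel})"
    unfolding atLeastLessThan_iff[symmetric] conj_assoc[symmetric] by blast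
  then show ?thesis unfolding past_sigma_def by (subst sets_measure_of) auto
qed

lemma sets_past_sigma_Suc: "sets (past_sigma M W k) \<subseteq> sets (past_sigma M W (Suc k))"
  unfolding sets_past_sigma by (rule sigma_sets_mono') force

lemma past_sigma_measurable:
  fixes W :: "nat \<Rightarrow> 'a \<Rightarrow> 'b :: topological_space"
  assumes "1 \<le> i" "i < k"
  shows "W i \<in> borel_measurable (past_sigma M W k)"
proof (rule measurableI)
  fix S :: "'b set" assume "S \<in> sets borel"
  then show "W i -` S \<inter> space (past_sigma M W k) \<in> sets (past_sigma M W k)"
    unfolding space_past_sigma sets_past_sigma using assms
    by (intro sigma_sets.Basic UN_I[of i]) auto
qed simp

lemma subalgebra_past_sigma:
  assumes "\<And>i. 1 \<le> i \<Longrightarrow> W i \<in> borel_measurable M"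
  shows "subalgebra M (past_sigma M W k)"
  unfolding subalgebra_def
proof
  show "space (past_sigma M W k) = space M" by (rule space_past_sigma)
  show "sets (past_sigma M W k) \<subseteq> sets M"
    unfolding sets_past_sigma using assms measurable_sets
    by (intro sets.sigma_sets_subset) fastforce
qed

lemma (in prob_space) indep_past_sigma:
  fixes W :: "nat \<Rightarrow> 'a \<Rightarrow> 'b :: topological_space"
  assumes "indep_vars (\<lambda>_. borel) W {1..}" "1 \<le> k"
  shows "indep_set (sets (past_sigma M W k)) (sets (vimage_algebra (space M) (W k) borel))"
proof -
  let ?E = "\<lambda>i. {W i -` S \<inter> space M | S. S \<in> sets borel}"
  let ?I = "case_bool {1..<k} {k}"
  have "indep_sets ?E {1..}" using assms(1) by (simp add: indep_vars_def2)
  moreover have "(\<Union>j. ?I j) \<subseteq> {1..}" using assms(2) by (auto split: bool.splits)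
  ultimately have "indep_sets ?E (\<Union>j. ?I j)" by (rule indep_sets_mono_index[rotated])
  then have "indep_sets (\<lambda>j. sigma_sets (space M) (\<Union>i\<in>?I j. ?E i)) UNIV"
  proof (rule indep_sets_collect_sigma)
    show "Int_stable (?E i)" for i
    proof (rule Int_stableI)
      fix a b assume "a \<in> ?E i" "b \<in> ?E i"
      then obtain S T where "a = W i -` S \<inter> space M" "b = W i -` T \<inter> space M"
        "S \<in> sets borel" "T \<in> sets borel" by blast
      then have "a \<inter> b = W i -` (S \<inter> T) \<inter> space M" "S \<inter> T \<in> sets borel" by auto
      then show "a \<inter> b \<in> ?E i" by blast
    qed
    show "disjoint_family ?I" by (auto simp: disjoint_family_on_def split: bool.splits)
  qed
  moreover have "sigma_sets (space M) (\<Union>i\<in>?I j. ?E i)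
      = case_bool (sets (past_sigma M W k)) (sets (vimage_algebra (space M) (W k) borel)) j" for j
    by (cases j) (simp_all add: sets_past_sigma sets_vimage_algebra)
  ultimately show ?thesis unfolding indep_set_def by simp
qed

lemma has_bochner_integral_identically_distributed:
  fixes h :: "'b :: topological_space \<Rightarrow> 'c :: {banach, second_countable_topology}"
  assumes "distr M borel X = distr M borel Y"
    and "X \<in> borel_measurable M" "Y \<in> borel_measurable M" "h \<in> borel_measurable borel"
    and "has_bochner_integral M (\<lambda>\<omega>. h (X \<omega>)) c"
  shows "has_bochner_integral M (\<lambda>\<omega>. h (Y \<omega>)) c"
  using assms integrable_distr_eq[of X M borel h] integrable_distr_eq[of Y M borel h]
    integral_distr[of X M borel h] integral_distr[of Y M borel h]
  by (simp add: has_bochner_integral_iff)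

lemma has_bochner_integral_matrix_vector_mult:
  fixes S :: "'a \<Rightarrow> real ^ 'n ^ 'm"
  assumes "has_bochner_integral M S P"
  shows "has_bochner_integral M (\<lambda>\<omega>. S \<omega> *v v) (P *v v)"
  by (rule has_bochner_integral_bounded_linear[OF
        bounded_bilinear.bounded_linear_left[OF bounded_bilinear_matrix_vector_mult] assms])

text \<open>The quadratic form of \<open>C = E[S S]\<close> at \<open>v\<close> is \<open>E[\<parallel>S v\<parallel>\<^sup>2]\<close>. If it vanished, \<open>S v\<close> would be \<open>0\<close> almost
  surely, contradicting \<open>E[S v] = \<beta> v\<close> unless \<open>v = 0\<close>.\<close>

lemma (in prob_space) second_moment_sym_pos_def:
  fixes S :: "'a \<Rightarrow> real ^ 'm ^ 'm"
  assumes sym: "\<And>\<omega>. transpose (S \<omega>) = S \<omega>"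
    and mean: "has_bochner_integral M S (\<beta> *\<^sub>R mat 1)" and "0 < \<beta>"
    and sq: "integrable M (\<lambda>\<omega>. (norm (S \<omega>))\<^sup>2)"
  shows "\<exists>C. has_bochner_integral M (\<lambda>\<omega>. S \<omega> ** S \<omega>) C \<and> sym_pos_def C"
proof -
  have [measurable]: "S \<in> borel_measurable M"
    using mean by (rule borel_measurable_has_bochner_integral)
  obtain c where c: "\<And>(P :: real ^ 'm ^ 'm) (Q :: real ^ 'm ^ 'm). norm (P ** Q) \<le> norm P * norm Q * c"
    using bounded_bilinear.bounded[OF bounded_bilinear_matrix_matrix_mult] by blast
  have "integrable M (\<lambda>\<omega>. S \<omega> ** S \<omega>)"
  proof (rule Bochner_Integration.integrable_bound)
    show "integrable M (\<lambda>\<omega>. c * (norm (S \<omega>))\<^sup>2)" using sq by simp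
    show "AE \<omega> in M. norm (S \<omega> ** S \<omega>) \<le> norm (c * (norm (S \<omega>))\<^sup>2)"
    proof (rule AE_I2)
      fix \<omega>
      have "norm (S \<omega> ** S \<omega>) \<le> c * (norm (S \<omega>))\<^sup>2"
        using c[of "S \<omega>" "S \<omega>"] by (simp add: power2_eq_square ac_simps)
      then show "norm (S \<omega> ** S \<omega>) \<le> norm (c * (norm (S \<omega>))\<^sup>2)" by simp
    qed
  qed measurable
  then obtain C where C: "has_bochner_integral M (\<lambda>\<omega>. S \<omega> ** S \<omega>) C"
    by (auto simp: has_bochner_integral_iff)
  have "has_bochner_integral M (\<lambda>\<omega>. transpose (S \<omega> ** S \<omega>)) (transpose C)"
    by (rule has_bochner_integral_bounded_linear[OF bounded_linear_transpose C])
  then have "transpose C = C"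
    using C by (auto simp: matrix_transpose_mul sym dest: has_bochner_integral_eq)
  moreover have "0 < v \<bullet> (C *v v)" if "v \<noteq> 0" for v
  proof -
    have "has_bochner_integral M (\<lambda>\<omega>. v \<bullet> ((S \<omega> ** S \<omega>) *v v)) (v \<bullet> (C *v v))"
      by (intro has_bochner_integral_inner_right has_bochner_integral_matrix_vector_mult C)
    then have sq: "has_bochner_integral M (\<lambda>\<omega>. (norm (S \<omega> *v v))\<^sup>2) (v \<bullet> (C *v v))"
      by (simp add: matrix_vector_mul_assoc[symmetric] inner_matrix_vector_adjoint[of v] sym
          power2_norm_eq_inner)
    have "v \<bullet> (C *v v) \<noteq> 0"
    proof
      assume "v \<bullet> (C *v v) = 0"
      then have "AE \<omega> in M. (norm (S \<omega> *v v))\<^sup>2 = 0"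
        using sq integral_nonneg_eq_0_iff_AE[of M "\<lambda>\<omega>. (norm (S \<omega> *v v))\<^sup>2"]
        by (auto simp: has_bochner_integral_iff)
      then have "(\<integral>\<omega>. S \<omega> *v v \<partial>M) = (\<integral>\<omega>. 0 \<partial>M)"
        by (intro integral_cong_AE) auto
      moreover have "(\<integral>\<omega>. S \<omega> *v v \<partial>M) = \<beta> *\<^sub>R v"
        using has_bochner_integral_matrix_vector_mult[OF mean, of v]
        by (auto simp: has_bochner_integral_iff scaleR_matrix_vector_assoc[symmetric])
      ultimately show False using \<open>v \<noteq> 0\<close> \<open>0 < \<beta>\<close> by simp
    qed
    moreover have "0 \<le> (\<integral>\<omega>. (norm (S \<omega> *v v))\<^sup>2 \<partial>M)" by simp
    then have "0 \<le> v \<bullet> (C *v v)" using has_bochner_integral_integral_eq[OF sq] by (simp only:)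
    ultimately show ?thesis by simp
  qed
  ultimately show ?thesis using C unfolding sym_pos_def_def by blast
qed

theorem theorem3p2:
  fixes M :: "'w measure"
    and A :: "real ^ 'n ^ 'm" and b bhat :: "real ^ 'm"
    and \<beta> Bmax :: real
    and W :: "nat \<Rightarrow> 'w \<Rightarrow> real ^ 'l ^ 'm"
    and \<alpha> :: "nat \<Rightarrow> real"
    and B :: "nat \<Rightarrow> 'w \<Rightarrow> real ^ 'n ^ 'n"
    and xhat x0 :: "real ^ 'n"
    and x s :: "nat \<Rightarrow> 'w \<Rightarrow> real ^ 'n"
    and bk :: "nat \<Rightarrow> 'w \<Rightarrow> real ^ 'm"
    and e :: "nat \<Rightarrow> 'w \<Rightarrow> real"
  assumes "prob_space M"
    and "rank A = CARD('n)"
    and "\<beta> > 0"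
    and "prob_space.indep_vars M (\<lambda>_. borel) W {1..}"
    and "\<forall>k\<ge>1. distr M borel (W k) = distr M borel (W 1)"
    and "\<forall>k\<ge>1. has_bochner_integral M (\<lambda>\<omega>. W k \<omega> ** transpose (W k \<omega>)) (\<beta> *\<^sub>R mat 1)"
    and "\<forall>k\<ge>1. integrable M (\<lambda>\<omega>. (spectral_norm (W k \<omega> ** transpose (W k \<omega>)))\<^sup>2)"
    and "\<forall>k\<ge>1. \<alpha> k > 0"
    and "\<forall>k\<ge>1. B k \<in> borel_measurable (past_sigma M W k)"
    and "\<forall>k\<ge>1. \<forall>\<omega>\<in>space M. sym_pos_def (B k \<omega>)"
    and "Bmax > 0"
    and "\<forall>k\<ge>1. AE \<omega> in M. spectral_norm (B k \<omega>) \<le> Bmax"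
    and "AE \<omega> in M. filterlim (\<lambda>N. \<Sum>k=1..N. \<alpha> k * lambda_min (B k \<omega>)) at_top sequentially"
    and "summable (\<lambda>k. (\<alpha> (Suc k))\<^sup>2)"
    and "xhat = matrix_inv (transpose A ** A) *v (transpose A *v b)"
    and "bhat = A *v xhat"
    and "\<forall>\<omega>\<in>space M. x 0 \<omega> = x0"
    and "\<forall>k\<ge>1. \<forall>\<omega>\<in>space M. x k \<omega> = x (k - 1) \<omega> + \<alpha> k *\<^sub>R s k \<omega>"
    and "\<forall>k\<ge>1. \<forall>\<omega>\<in>space M. s k \<omega> =
           - ((B k \<omega> ** transpose A ** W k \<omega> ** transpose (W k \<omega>)) *v (A *v x (k - 1) \<omega> - b))"
    and "\<forall>k\<ge>1. \<forall>\<omega>\<in>space M. bk k \<omega> = A *v x (k - 1) \<omega>"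
    and "\<forall>k\<ge>1. \<forall>\<omega>\<in>space M. e k \<omega> = (norm (bk k \<omega> - bhat))\<^sup>2"
  shows "(\<exists>C. (\<forall>k\<ge>1. has_bochner_integral M
                 (\<lambda>\<omega>. W k \<omega> ** transpose (W k \<omega>) ** W k \<omega> ** transpose (W k \<omega>)) C) \<and>
              sym_pos_def C)
       \<and> (\<forall>k\<ge>1. integrable M (e k) \<and> integrable M (\<lambda>\<omega>. (norm (s k \<omega>))\<^sup>2))
       \<and> (AE \<omega> in M. (\<lambda>k. x k \<omega>) \<longlonglongrightarrow> xhat)"
proof -
  interpret prob_space M by (rule assms(1))
  define r where "r = b - A *v xhat"
  define S where "S k \<omega> = W (Suc k) \<omega> ** transpose (W (Suc k) \<omega>)" for k \<omega>
  \<comment> \<open>Indices are shifted by one: step \<open>k\<close> of the abstract recursion is step \<open>Suc k\<close> of the algorithm, and its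
    history consists of the sketches used to compute \<open>x k\<close>.\<close>
  define F where "F k = past_sigma M W (Suc k)" for k
  define u where "u k \<omega> = x k \<omega> - xhat" for k \<omega>
  have W: "W k \<in> borel_measurable M" if "1 \<le> k" for k
    using assms(4) that by (simp add: indep_vars_def2)
  have Sm [measurable]: "S k \<in> borel_measurable M" for k
    unfolding S_def[abs_def] using W[of "Suc k"] by measurable
  have S_symmetric: "transpose (S k \<omega>) = S k \<omega>" for k \<omega>
    by (simp add: S_def matrix_transpose_mul)
  have S_mean: "has_bochner_integral M (S k) (\<beta> *\<^sub>R mat 1)" for k
    using assms(6) unfolding S_def[abs_def] by simp
  have S_distr: "distr M borel (W (Suc 0)) = distr M borel (W (Suc k))" for k
  proof -
    have "distr M borel (W (Suc k)) = distr M borel (W 1)"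
      by (rule assms(5)[rule_format]) simp
    then show ?thesis by simp
  qed
  have "integrable M (\<lambda>\<omega>. (norm (S 0 \<omega>))\<^sup>2)"
  proof (rule Bochner_Integration.integrable_bound)
    have "integrable M (\<lambda>\<omega>. (spectral_norm (S 0 \<omega>))\<^sup>2)"
      using assms(7) by (simp add: S_def)
    then show "integrable M (\<lambda>\<omega>. (real CARD('m) * real CARD('m))\<^sup>2 * (spectral_norm (S 0 \<omega>))\<^sup>2)"
      by simp
    show "AE \<omega> in M. norm ((norm (S 0 \<omega>))\<^sup>2)
        \<le> norm ((real CARD('m) * real CARD('m))\<^sup>2 * (spectral_norm (S 0 \<omega>))\<^sup>2)"
    proof (rule AE_I2)
      fix \<omega>
      from power_mono[OF norm_le_spectral_norm[of "S 0 \<omega>"] norm_ge_zero, of 2]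
      show "norm ((norm (S 0 \<omega>))\<^sup>2)
          \<le> norm ((real CARD('m) * real CARD('m))\<^sup>2 * (spectral_norm (S 0 \<omega>))\<^sup>2)"
        by (simp add: power_mult_distrib)
    qed
  qed measurable
  then obtain \<mu> where "has_bochner_integral M (\<lambda>\<omega>. (norm (S 0 \<omega>))\<^sup>2) \<mu>"
    by (auto simp: has_bochner_integral_iff)
  then have S_second: "has_bochner_integral M (\<lambda>\<omega>. (norm (S k \<omega>))\<^sup>2) \<mu>" for k
    unfolding S_def
    by (rule has_bochner_integral_identically_distributed[OF S_distr, rotated 3]) (auto intro: W)
  have gram: "invertible (transpose A ** A)" by (rule full_rank_gram_invertible[OF assms(2)])
  have s_eq: "s (Suc k) \<omega> = - (B (Suc k) \<omega> *v (transpose A *v (S k \<omega> *v (A *v u k \<omega> - r))))"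
    if "\<omega> \<in> space M" for k \<omega>
  proof -
    have "A *v x k \<omega> - b = A *v u k \<omega> - r"
      by (simp add: u_def r_def matrix_vector_mult_diff_distrib)
    then show ?thesis
      using assms(19) that by (simp add: S_def matrix_vector_mul_assoc matrix_mul_assoc)
  qed
  interpret sketched_gradient_descent M F A r S "\<lambda>k. B (Suc k)" "\<lambda>k. \<alpha> (Suc k)" \<beta> Bmax \<mu> u
  proof
    show "subalgebra M (F k)" for k
      unfolding F_def by (rule subalgebra_past_sigma) (rule W)
    show "sets (F k) \<subseteq> sets (F (Suc k))" for k
      unfolding F_def by (rule sets_past_sigma_Suc)
    show "S k \<in> borel_measurable (F (Suc k))" for k
      unfolding F_def S_def[abs_def]
      using past_sigma_measurable[of "Suc k" "Suc (Suc k)" W M] by measurable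
    show "indep_set (sets (F k)) (sets (vimage_algebra (space M) (S k) borel))" for k
    proof -
      let ?N = "vimage_algebra (space M) (W (Suc k)) borel"
      have "W (Suc k) \<in> borel_measurable ?N" by (intro measurable_vimage_algebra1) simp
      then have "S k \<in> borel_measurable ?N" unfolding S_def[abs_def] by measurable
      then have "sets (vimage_algebra (space M) (S k) borel) \<subseteq> sets ?N"
        by (intro sets_image_in_sets) auto
      then show ?thesis
        using indep_past_sigma[OF assms(4), of "Suc k"] unfolding F_def indep_sets2_eq by auto
    qed
    show "B (Suc k) \<in> borel_measurable (F k)" for k
      using assms(9) by (simp add: F_def)
    show "u 0 \<in> borel_measurable (F 0)"
      by (subst measurable_cong[of "F 0" _ "\<lambda>_. x0 - xhat"])
        (use assms(17) in \<open>auto simp: u_def F_def space_past_sigma\<close>)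
    show "integrable M (\<lambda>\<omega>. (norm (u 0 \<omega>))\<^sup>2)"
      by (subst Bochner_Integration.integrable_cong[OF refl, of M _ "\<lambda>_. (norm (x0 - xhat))\<^sup>2"])
        (use assms(17) in \<open>auto simp: u_def\<close>)
    show "transpose A *v r = 0"
      unfolding r_def by (rule least_squares_residual[OF gram assms(15)])
    show "u (Suc k) \<omega> = u k \<omega>
        - \<alpha> (Suc k) *\<^sub>R (B (Suc k) \<omega> *v (transpose A *v (S k \<omega> *v (A *v u k \<omega> - r))))"
      if "\<omega> \<in> space M" for k \<omega>
      using assms(18) that s_eq[OF that, of k] by (simp add: u_def)
  qed (use assms(3,8,10,12,14) S_mean S_second gram in auto)
  show ?thesis
  proof (intro conjI allI impI)
    obtain C where C: "has_bochner_integral M (\<lambda>\<omega>. S 0 \<omega> ** S 0 \<omega>) C" "sym_pos_def C"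
      using second_moment_sym_pos_def[OF S_symmetric S_mean assms(3), of 0] S_second[of 0]
      by (auto simp: has_bochner_integral_iff)
    have "has_bochner_integral M (\<lambda>\<omega>. S k \<omega> ** S k \<omega>) C" for k
      using C(1) unfolding S_def
      by (rule has_bochner_integral_identically_distributed[OF S_distr, rotated 3]) (auto intro: W)
    then have "has_bochner_integral M
        (\<lambda>\<omega>. W k \<omega> ** transpose (W k \<omega>) ** W k \<omega> ** transpose (W k \<omega>)) C" if "1 \<le> k" for k
      using that by (cases k) (simp_all add: S_def matrix_mul_assoc)
    then show "\<exists>C. (\<forall>k\<ge>1. has_bochner_integral M
        (\<lambda>\<omega>. W k \<omega> ** transpose (W k \<omega>) ** W k \<omega> ** transpose (W k \<omega>)) C) \<and> sym_pos_def C"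
      using C(2) by blast
  next
    fix k :: nat assume "1 \<le> k"
    then obtain j where k: "k = Suc j" by (cases k) auto
    have "e k \<omega> = err j \<omega>" if "\<omega> \<in> space M" for \<omega>
      using assms(16,20,21) that by (simp add: k err_def u_def matrix_vector_mult_diff_distrib)
    then show "integrable M (e k)"
      using integrable_err[of j] by (simp cong: Bochner_Integration.integrable_cong)
    have "(norm (s k \<omega>))\<^sup>2 = (norm (direction j \<omega>))\<^sup>2" if "\<omega> \<in> space M" for \<omega>
      using s_eq[OF that, of j] by (simp add: k direction_def res_def)
    then show "integrable M (\<lambda>\<omega>. (norm (s k \<omega>))\<^sup>2)"
      using square_integrable_direction[OF square_integrable_u, of j]
      by (simp cong: Bochner_Integration.integrable_cong)
  next
    have "AE \<omega> in M. filterlim (\<lambda>N. \<Sum>k<N. \<alpha> (Suc k) * lambda_min (B (Suc k) \<omega>)) at_top sequentially"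
      using assms(13) by (simp add: sum.atLeast1_atMost_eq)
    then have "AE \<omega> in M. (\<lambda>k. u k \<omega>) \<longlonglongrightarrow> 0" by (rule AE_error_tendsto_zero)
    then show "AE \<omega> in M. (\<lambda>k. x k \<omega>) \<longlonglongrightarrow> xhat"
      by eventually_elim (simp add: u_def LIM_zero_iff)
  qed
qed

end
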